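(* Let $r\ge3$, $V=\mathbb{F}_{q^n}^r$, and let $U,W$ be $\mathbb{F}_q$-subspaces of $V$ with $\dim_{\mathbb{F}_q}U=\dim_{\mathbb{F}_q}W=(r-1)n$ and $L_U=L_W$ in $\mathrm{PG}(r-1,q^n)$. Let $\ell=\mathrm{PG}(T,q^n)$ be a line, $T$ a $2$-dimensional $\mathbb{F}_{q^n}$-subspace of $V$, and put $U_0=U\cap T$, $W_0=W\cap T$. Suppose $\dim_{\mathbb{F}_q}U_0=\dim_{\mathbb{F}_q}W_0=n$ and that $L_{U_0}=L_{W_0}$ is a linear set of pseudoregulus type with maximum field of linearity $\mathbb{F}_q$. Then either $W=\lambda U$ for some $\lambda\in\mathbb{F}_{q^n}^*$, or $L_U=L_W$ is a cone with vertex a codimension-$2$ projective subspace of $\mathrm{PG}(r-1,q^n)$ disjoint from $\ell$ and base $L_{U_0}=L_{W_0}$.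
   Context: $L_X=\{\langle u\rangle_{\mathbb{F}_{q^n}}:u\in X\setminus\{0\}\}$. A linear set $L_{U_0}$ of a line $\ell\cong\mathrm{PG}(1,q^n)$ with $\dim_{\mathbb{F}_q}U_0=n$ is of pseudoregulus type if $U_0=\{\mu v_0+\mu^{q^i}v_1:\mu\in\mathbb{F}_{q^n}\}$ for some $i$ and $\mathbb{F}_{q^n}$-independent $v_0,v_1\in T$. The maximum field of linearity of $L$ is $\mathbb{F}_{q^e}$ with $e\mid n$ largest such that $L=L_{X}$ for some $\mathbb{F}_{q^e}$-subspace $X$. A cone with vertex a subspace $\Lambda$ and base a set $\mathcal B\subseteq\ell$ (with $\Lambda\cap\ell=\emptyset$) is the union of the subspaces $\langle\Lambda,P\rangle$, $P\in\mathcal B$. *)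

theory Defs
  imports Main "HOL-Library.Function_Algebras" "HOL-Library.Cardinality"
begin

text \<open>Setting: the field F_{q^n} is a finite field type 'a with CARD('a) = q^n;
  V = F_{q^n}^r is modelled as the functions 'r \<Rightarrow> 'a with r = CARD('r).
  A subfield F_{q^e} of F_{q^n} (e dividing n) is the set of roots of x^(q^e) - x.\<close>

definition subfield_of_order :: "nat \<Rightarrow> 'a::field set" where
  "subfield_of_order m = {x. x ^ m = x}"

definition vsmult :: "'a::field \<Rightarrow> ('r \<Rightarrow> 'a) \<Rightarrow> ('r \<Rightarrow> 'a)" where
  "vsmult c v = (\<lambda>i. c * v i)"

definition K_subspace :: "'a::field set \<Rightarrow> ('r \<Rightarrow> 'a) set \<Rightarrow> bool" where
  "K_subspace K X \<longleftrightarrow> 0 \<in> X \<and> (\<forall>u\<in>X. \<forall>v\<in>X. u + v \<in> X)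
     \<and> (\<forall>c\<in>K. \<forall>v\<in>X. vsmult c v \<in> X)"

definition K_span :: "'a::field set \<Rightarrow> ('r \<Rightarrow> 'a) set \<Rightarrow> ('r \<Rightarrow> 'a) set" where
  "K_span K B = {(\<Sum>v\<in>B. vsmult (c v) v) | c. \<forall>v\<in>B. c v \<in> K}"

definition K_indep :: "'a::field set \<Rightarrow> ('r \<Rightarrow> 'a) set \<Rightarrow> bool" where
  "K_indep K B \<longleftrightarrow> (\<forall>c. (\<forall>v\<in>B. c v \<in> K) \<longrightarrow> (\<Sum>v\<in>B. vsmult (c v) v) = 0
       \<longrightarrow> (\<forall>v\<in>B. c v = 0))"

definition K_dim :: "'a::field set \<Rightarrow> ('r \<Rightarrow> 'a) set \<Rightarrow> nat \<Rightarrow> bool" where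
  "K_dim K X d \<longleftrightarrow> (\<exists>B. finite B \<and> card B = d \<and> K_indep K B \<and> K_span K B = X)"

definition ppoint :: "('r \<Rightarrow> 'a::field) \<Rightarrow> ('r \<Rightarrow> 'a) set" where
  "ppoint u = {vsmult c u | c. True}"

text \<open>L_X = { \<langle>u\<rangle> : u \<in> X \<setminus> {0} }; also the point set of a projective subspace PG(S,q^n).\<close>
definition Lset :: "('r \<Rightarrow> 'a::field) set \<Rightarrow> ('r \<Rightarrow> 'a) set set" where
  "Lset X = ppoint ` (X - {0})"

definition pseudoregulus_type :: "nat \<Rightarrow> ('r \<Rightarrow> 'a::field) set \<Rightarrow> ('r \<Rightarrow> 'a) set set \<Rightarrow> bool" where
  "pseudoregulus_type q T L \<longleftrightarrow> (\<exists>i v0 v1. v0 \<in> T \<and> v1 \<in> T \<and> K_indep UNIV {v0, v1} \<and> v0 \<noteq> v1 \<and>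
      L = Lset {vsmult \<mu> v0 + vsmult (\<mu> ^ (q ^ i)) v1 | \<mu>. True})"

definition max_linearity_exp :: "nat \<Rightarrow> nat \<Rightarrow> ('r \<Rightarrow> 'a::field) set set \<Rightarrow> nat" where
  "max_linearity_exp q n L = (GREATEST e. e dvd n \<and>
      (\<exists>X. K_subspace (subfield_of_order (q ^ e)) X \<and> L = Lset X))"

definition cone :: "('r \<Rightarrow> 'a::field) set \<Rightarrow> ('r \<Rightarrow> 'a) set set \<Rightarrow> ('r \<Rightarrow> 'a) set set" where
  "cone Lam B = (\<Union>P\<in>B. Lset {a + b | a b. a \<in> Lam \<and> b \<in> P})"

end

theory Submission
  imports Defs "HOL-Number_Theory.Cong" "HOL-Computational_Algebra.Polynomial" "HOL-Algebra.Sylow"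
begin

text \<open>
  Write \<open>\<sigma> = q\<^sup>j\<close>. In coordinates \<open>\<alpha>, \<beta>\<close> adapted to the line, \<open>U\<close> is, up to a scalar, the graph
  \<open>\<beta> = \<alpha>\<^sup>\<sigma> + G\<close> of an \<open>F\<^sub>q\<close>-linear function \<open>G\<close> vanishing on \<open>T\<close>, and \<open>W\<close> is \<open>\<beta> = \<alpha>\<^sup>\<tau> + H\<close>.
  Two additive maps \<open>f, h\<close> with the same set of directions \<open>f x / x\<close> have the same power sums
  \<open>\<Sum> (f x / x)\<^sup>B\<close> for every \<open>B\<close>. Taking for \<open>B\<close> a sum of distinct powers of \<open>q\<close>, such a power sum
  is, up to sign, a permanent of a principal submatrix of the Dickson matrix of \<open>f\<close>, because base \<open>q\<close> digits
  are unique modulo \<open>q\<^sup>n - 1\<close>.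

  Applied on the line, this shows that any \<open>F\<^sub>q\<close>-subspace of rank \<open>n\<close> defining a linear set of
  pseudoregulus type is a multiple of some \<open>{(x, x\<^sup>\<tau>)}\<close>: the shortest closed walk in the Cayley
  digraph on \<open>\<int>/n\<close> given by the support of \<open>f\<close> has no chord, hence contributes a nonzero permanent,
  hence has length \<open>n\<close>. Applied to the pencil of maps \<open>x \<mapsto> (a x)\<^sup>\<sigma> + G (x v)\<close> and compared
  coefficientwise in \<open>a\<close>, it gives that \<open>G (x v)\<close> only involves \<open>x\<close> and \<open>x\<^sup>\<sigma>\<close> (so that \<open>U\<close> is a cone),
  or else \<open>\<sigma> = \<tau>\<close> and \<open>G = H\<close>.
\<close>

section \<open>Sums of powers of q modulo q^n - 1\<close>

lemma digit_sum_less: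
  fixes q :: nat
  assumes "\<And>i. i < n \<Longrightarrow> c i < q"
  shows "(\<Sum>i<n. c i * q ^ i) < q ^ n"
  using assms
proof (induction n)
  case (Suc n)
  have "(\<Sum>i<n. c i * q ^ i) < q ^ n" using Suc by simp
  moreover have "Suc (c n) * q ^ n \<le> q * q ^ n"
    using Suc.prems[of n] by (intro mult_right_mono) auto
  ultimately show ?case by simp
qed simp

lemma digits_unique:
  fixes q :: nat
  assumes "\<And>i. i < n \<Longrightarrow> c i < q" "\<And>i. i < n \<Longrightarrow> d i < q"
    and "(\<Sum>i<n. c i * q ^ i) = (\<Sum>i<n. d i * q ^ i)" and "i < n"
  shows "c i = d i"
  using assms
proof (induction n arbitrary: i)
  case (Suc n)
  let ?C = "\<Sum>i<n. c i * q ^ i" and ?D = "\<Sum>i<n. d i * q ^ i"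
  have less: "?C < q ^ n" "?D < q ^ n"
    by (rule digit_sum_less; use Suc.prems in simp)+
  have eq: "?C + c n * q ^ n = ?D + d n * q ^ n" using Suc.prems(3) by simp
  have "(x + y * m) div m = y" if "x < m" for x y m :: nat using that by simp
  from this[OF less(1)] this[OF less(2)]
  have "(?C + c n * q ^ n) div q ^ n = c n" "(?D + d n * q ^ n) div q ^ n = d n" .
  with eq have top: "c n = d n" by simp
  with eq have "?C = ?D" by simp
  with Suc top show ?case by (cases "i = n") auto
qed simp

lemma repunit_sum:
  fixes q :: nat
  assumes "q \<ge> 1"
  shows "(\<Sum>i<n. (q - 1) * q ^ i) = q ^ n - 1"
proof -
  obtain k where k: "q = Suc k" using assms by (cases q) auto
  have "(\<Sum>i<n. k * Suc k ^ i) + 1 = Suc k ^ n"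
    by (induction n) (auto simp: algebra_simps)
  with k show ?thesis by simp
qed

text \<open>Both sides are base q expansions between 0 and q^n - 1, where only 0 and q^n - 1 are
  congruent without being equal. The value q^n - 1 has all digits q - 1; a proper subset
  \<open>I\<close> never reaches it, and \<open>ne\<close> excludes it for \<open>c\<close> when
  \<open>I\<close> is empty.\<close>

lemma digits_cong_indicator:
  fixes q :: nat
  assumes q: "q \<ge> 2" and c: "\<And>i. i < n \<Longrightarrow> c i < q"
    and I: "I \<subset> {..<n}"
    and cong: "[(\<Sum>i<n. c i * q ^ i) = (\<Sum>i\<in>I. q ^ i)] (mod (q ^ n - 1))"
    and ne: "I \<noteq> {} \<or> (\<exists>i<n. c i \<noteq> q - 1)" and i: "i < n"
  shows "c i = (if i \<in> I then 1 else 0)"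
proof -
  let ?d = "\<lambda>i. if i \<in> I then 1 else (0::nat)"
  have dsum: "(\<Sum>i\<in>I. q ^ i) = (\<Sum>i<n. ?d i * q ^ i)"
    using I by (intro sum.mono_neutral_cong_left) auto
  have d: "?d i < q" for i using q by auto
  have "(\<Sum>i<n. ?d i * q ^ i) \<noteq> q ^ n - 1"
  proof
    assume "(\<Sum>i<n. ?d i * q ^ i) = q ^ n - 1"
    then have "(\<Sum>i<n. ?d i * q ^ i) = (\<Sum>i<n. (q - 1) * q ^ i)"
      using repunit_sum[of q n] q by simp
    then have "?d i = q - 1" if "i < n" for i
      using digits_unique[of n ?d q "\<lambda>_. q - 1", OF d _ _ that] q by fastforce
    then have "i \<in> I" if "i < n" for i using q that by (cases "i \<in> I") force+
    with I show False by auto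
  qed
  moreover have "(\<Sum>i<n. ?d i * q ^ i) < q ^ n" by (rule digit_sum_less[OF d])
  ultimately have dl: "(\<Sum>i<n. ?d i * q ^ i) < q ^ n - 1" by linarith
  have cl: "(\<Sum>i<n. c i * q ^ i) < q ^ n" by (rule digit_sum_less[OF c])
  have "(\<Sum>i<n. c i * q ^ i) \<noteq> q ^ n - 1"
  proof
    assume *: "(\<Sum>i<n. c i * q ^ i) = q ^ n - 1"
    then have "(\<Sum>i<n. c i * q ^ i) = (\<Sum>i<n. (q - 1) * q ^ i)"
      using repunit_sum[of q n] q by simp
    then have all: "c i = q - 1" if "i < n" for i
      using digits_unique[of n c q "\<lambda>_. q - 1", OF c _ _ that] q by fastforce
    have "(\<Sum>i\<in>I. q ^ i) mod (q ^ n - 1) = 0"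
      using cong * by (simp add: cong_def)
    then have "(\<Sum>i\<in>I. q ^ i) = 0" using dl dsum by simp
    then have "I = {}" using I q finite_subset[of I "{..<n}"] by (auto simp: sum_eq_0_iff)
    with ne all show False by auto
  qed
  with cl have "(\<Sum>i<n. c i * q ^ i) < q ^ n - 1" by linarith
  with cong dl dsum have "(\<Sum>i<n. c i * q ^ i) = (\<Sum>i<n. ?d i * q ^ i)"
    by (simp add: cong_def)
  from digits_unique[OF c d this i] show ?thesis .
qed

lemma power_cong_one:
  fixes q :: nat
  assumes "q \<ge> 1"
  shows "[q ^ n = 1] (mod (q ^ n - 1))"
  using assms by (subst cong_altdef_nat) auto

text \<open>Carrying \<open>q \<cdot> q\<^sup>i = q\<^sup>i\<^sup>+\<^sup>1\<close> strictly lowers the sum of the digits, so a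
  representation with the minimal number of summands is carry-free.\<close>

lemma digits_cong_indicator_min:
  fixes q :: nat
  assumes q: "q \<ge> 2" and I: "I \<subset> {..<n}"
    and cong: "[(\<Sum>i<n. c i * q ^ i) = (\<Sum>i\<in>I. q ^ i)] (mod (q ^ n - 1))"
    and le: "(\<Sum>i<n. c i) \<le> card I"
  shows "\<forall>i<n. c i = (if i \<in> I then 1 else 0)"
  using cong le
proof (induction "\<Sum>i<n. c i" arbitrary: c rule: less_induct)
  case less
  show ?case
  proof (cases "\<exists>i<n. c i \<ge> q")
    case True
    then obtain i where i: "i < n" "c i \<ge> q" by blast
    \<comment> \<open>Since q^n is 1 modulo q^n - 1, the carry out of the top position n - 1 goes to
      position 0.\<close>
    define j where "j = Suc i mod n"
    have j: "j < n" using i by (simp add: j_def)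
    define c1 where "c1 = c(i := c i - q)"
    define c2 where "c2 = c1(j := c1 j + 1)"
    have split: "(\<Sum>k<n. f k * w k) = f l * w l + (\<Sum>k\<in>{..<n}-{l}. f k * w k)"
      if "l < n" for l and f w :: "nat \<Rightarrow> nat"
      using that by (subst sum.remove[of _ l]) auto
    have s1: "(\<Sum>k<n. c1 k * w k) + q * w i = (\<Sum>k<n. c k * w k)" for w
    proof -
      have "(\<Sum>k\<in>{..<n}-{i}. c1 k * w k) = (\<Sum>k\<in>{..<n}-{i}. c k * w k)"
        by (rule sum.cong) (auto simp: c1_def)
      moreover have "(c i - q) * w i + q * w i = c i * w i"
        using i by (simp flip: distrib_right)
      ultimately show ?thesis using split[OF i(1), of c1 w] split[OF i(1), of c w]
        by (simp add: c1_def)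
    qed
    have s2: "(\<Sum>k<n. c2 k * w k) = (\<Sum>k<n. c1 k * w k) + w j" for w
    proof -
      have "(\<Sum>k\<in>{..<n}-{j}. c2 k * w k) = (\<Sum>k\<in>{..<n}-{j}. c1 k * w k)"
        by (rule sum.cong) (auto simp: c2_def)
      then show ?thesis using split[OF j, of c1 w] split[OF j, of c2 w]
        by (simp add: c2_def algebra_simps)
    qed
    have lt: "(\<Sum>k<n. c2 k) < (\<Sum>k<n. c k)"
      using s1[of "\<lambda>_. 1"] s2[of "\<lambda>_. 1"] q by simp
    have "[q ^ j = q * q ^ i] (mod (q ^ n - 1))"
    proof (cases "Suc i < n")
      case False
      then have "Suc i = n" using i by simp
      then have "j = 0" "q * q ^ i = q ^ n" by (auto simp: j_def)
      moreover have "[q ^ n = 1] (mod (q ^ n - 1))"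
        using q by (intro power_cong_one) simp
      ultimately show ?thesis by (simp add: cong_sym)
    qed (simp add: j_def)
    then have "[(\<Sum>k<n. c1 k * q ^ k) + q ^ j = (\<Sum>k<n. c1 k * q ^ k) + q * q ^ i] (mod (q ^ n - 1))"
      by (intro cong_add cong_refl)
    then have "[(\<Sum>k<n. c2 k * q ^ k) = (\<Sum>k<n. c k * q ^ k)] (mod (q ^ n - 1))"
      using s1[of "\<lambda>k. q ^ k"] s2[of "\<lambda>k. q ^ k"] by simp
    then have "[(\<Sum>k<n. c2 k * q ^ k) = (\<Sum>i\<in>I. q ^ i)] (mod (q ^ n - 1))"
      using less.prems(1) cong_trans by blast
    from less.hyps[OF lt this] lt less.prems(2)
    have "\<forall>i<n. c2 i = (if i \<in> I then 1 else 0)" by simp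
    \<comment> \<open>By the induction hypothesis the digits after the carry sum to
      \<open>card I\<close>, but a carry strictly lowers the digit sum, which was at most
      \<open>card I\<close> before. So no digit reaches q.\<close>
    then have "(\<Sum>k<n. c2 k) = (\<Sum>k<n. if k \<in> I then 1 else 0)" by (intro sum.cong) auto
    also have "\<dots> = card I" using I by (simp add: sum.If_cases Int_absorb1 psubset_imp_subset)
    finally show ?thesis using lt less.prems(2) by simp
  next
    case False
    then have c: "\<And>i. i < n \<Longrightarrow> c i < q" by force
    have "I \<noteq> {} \<or> (\<exists>i<n. c i \<noteq> q - 1)"
    proof (rule ccontr)
      assume "\<not> ?thesis"
      then have "I = {}" and all: "\<forall>i<n. c i = q - 1" by auto
      then have "(\<Sum>i<n. c i) = 0" using less.prems(2) by (metis card.empty le_zero_eq)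
      then have "\<forall>i<n. c i = 0" by (simp only: sum_eq_0_iff finite_lessThan) auto
      moreover have "n > 0" using I by (cases n) auto
      ultimately have "c 0 = 0" "c 0 = q - 1" using all by blast+
      then show False using q by simp
    qed
    then show ?thesis using digits_cong_indicator[OF q c I less.prems(1)] by blast
  qed
qed

lemma power_cong_mod_exponent:
  fixes q :: nat
  assumes "q \<ge> 1"
  shows "[q ^ k = q ^ (k mod n)] (mod (q ^ n - 1))"
proof -
  have "[q ^ n = 1] (mod (q ^ n - 1))"
    by (rule power_cong_one[OF assms])
  then have "[(q ^ n) ^ (k div n) * q ^ (k mod n) = 1 ^ (k div n) * q ^ (k mod n)] (mod (q ^ n - 1))"
    by (intro cong_mult cong_pow cong_refl)
  then show ?thesis by (simp flip: power_mult power_add)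
qed

lemma power_sum_cong_mod_exponent:
  fixes q :: nat
  assumes "q \<ge> 1"
  shows "[(\<Sum>s\<in>A. q ^ f s) = (\<Sum>s\<in>A. q ^ (f s mod n))] (mod (q ^ n - 1))"
  using assms by (intro cong_sum power_cong_mod_exponent)

text \<open>The multiplicities of the exponents modulo n act as digits. The exponents from
  \<open>N\<close> are distinct and fewer than n, so they form an admissible \<open>I\<close>. On
  the side of \<open>M\<close> carries are excluded because \<open>M\<close> is no larger than
  \<open>N\<close>, or because its exponents are distinct too and every digit is at most 1.\<close>

lemma power_sums_cong_imp_bij:
  fixes q :: nat
  assumes q: "q \<ge> 2" and n: "n > 0" and fin: "finite M" "finite N"
    and inj: "inj_on (\<lambda>s. \<psi> s mod n) N" and N: "card N < n"
    and cong: "[(\<Sum>s\<in>M. q ^ \<phi> s) = (\<Sum>s\<in>N. q ^ \<psi> s)] (mod (q ^ n - 1))"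
    and M: "card M \<le> card N \<or> (inj_on (\<lambda>s. \<phi> s mod n) M \<and> card M < n)"
  shows "inj_on (\<lambda>s. \<phi> s mod n) M \<and> (\<lambda>s. \<phi> s mod n) ` M = (\<lambda>s. \<psi> s mod n) ` N"
proof -
  define I where "I = (\<lambda>s. \<psi> s mod n) ` N"
  define c where "c i = card {s \<in> M. \<phi> s mod n = i}" for i
  have cI: "card I = card N" unfolding I_def by (rule card_image[OF inj])
  have I: "I \<subset> {..<n}"
  proof -
    have "I \<subseteq> {..<n}" using n by (auto simp: I_def)
    moreover have "I \<noteq> {..<n}" using cI N by auto
    ultimately show ?thesis by blast
  qed
  have group: "(\<Sum>i<n. c i * w i) = (\<Sum>s\<in>M. w (\<phi> s mod n))" for w :: "nat \<Rightarrow> nat"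
  proof -
    have "(\<Sum>s\<in>M. w (\<phi> s mod n)) = (\<Sum>i<n. \<Sum>s | s \<in> M \<and> \<phi> s mod n = i. w (\<phi> s mod n))"
      by (rule sum.group[symmetric]) (use fin n in auto)
    also have "\<dots> = (\<Sum>i<n. c i * w i)"
      by (intro sum.cong refl) (simp add: c_def)
    finally show ?thesis ..
  qed
  have sI: "(\<Sum>i\<in>I. q ^ i) = (\<Sum>s\<in>N. q ^ (\<psi> s mod n))"
    unfolding I_def by (subst sum.reindex[OF inj]) simp
  have C: "[(\<Sum>i<n. c i * q ^ i) = (\<Sum>i\<in>I. q ^ i)] (mod (q ^ n - 1))"
    unfolding group sI by (rule cong_trans[OF cong_sym[OF power_sum_cong_mod_exponent] cong_trans[OF cong power_sum_cong_mod_exponent]]) (use q in simp_all)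
  have sc: "(\<Sum>i<n. c i) = card M" using group[of "\<lambda>_. 1"] by simp
  have ci: "c i = (if i \<in> I then 1 else 0)" if i: "i < n" for i
    using M
  proof
    assume "card M \<le> card N"
    then show ?thesis using digits_cong_indicator_min[OF q I C] sc cI i by simp
  next
    assume inj: "inj_on (\<lambda>s. \<phi> s mod n) M \<and> card M < n"
    have c1: "c i \<le> 1" for i
      unfolding c_def using inj fin by (subst One_nat_def, subst card_le_Suc0_iff_eq) (auto dest: inj_onD)
    \<comment> \<open>If all digits were q - 1, their sum would be n (q - 1), which is at least n,
      against \<open>card M < n\<close>.\<close>
    have "\<exists>i<n. c i \<noteq> q - 1"
    proof (rule ccontr)
      assume "\<not> ?thesis"
      then have "(\<Sum>i<n. c i) = n * (q - 1)" by simp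
      moreover have "n * (q - 1) \<ge> n * 1" using q by (intro mult_le_mono) auto
      ultimately show False using sc inj by simp
    qed
    moreover have "c i < q" for i using c1[of i] q by simp
    ultimately show ?thesis using digits_cong_indicator[OF q _ I C _ i] by blast
  qed
  have "inj_on (\<lambda>s. \<phi> s mod n) M"
  proof (rule inj_onI)
    fix s t assume st: "s \<in> M" "t \<in> M" "\<phi> s mod n = \<phi> t mod n"
    have "c (\<phi> s mod n) \<le> 1" using ci[of "\<phi> s mod n"] n by simp
    then show "s = t" using st fin unfolding c_def
      by (subst (asm) One_nat_def, subst (asm) card_le_Suc0_iff_eq) auto
  qed
  moreover have "(\<lambda>s. \<phi> s mod n) ` M = I"
  proof
    show "(\<lambda>s. \<phi> s mod n) ` M \<subseteq> I"
    proof
      fix i assume "i \<in> (\<lambda>s. \<phi> s mod n) ` M"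
      then have "c i \<noteq> 0" "i < n" using fin n by (auto simp: c_def card_eq_0_iff)
      with ci show "i \<in> I" by (metis)
    qed
    show "I \<subseteq> (\<lambda>s. \<phi> s mod n) ` M"
    proof
      fix i assume i: "i \<in> I"
      then have "c i = 1" using ci I by auto
      then have "{s \<in> M. \<phi> s mod n = i} \<noteq> {}" unfolding c_def by (metis card.empty zero_neq_one)
      then show "i \<in> (\<lambda>s. \<phi> s mod n) ` M" by auto
    qed
  qed
  ultimately show ?thesis unfolding I_def by blast
qed

lemma coprime_mult_mod_cancel:
  fixes j n :: nat
  assumes "coprime j n" "(j * a) mod n = (j * b) mod n"
  shows "a mod n = b mod n"
  using assms cong_mult_lcancel_nat[of j n a b] by (simp add: cong_def coprime_commute)

text \<open>As j is invertible modulo n, multiplication by j permutes the residues, so powers of q^j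
  can be compared through the exponents of q.\<close>

lemma conjugate_sums_cong_imp_bij:
  fixes q :: nat
  assumes q: "q \<ge> 2" and n: "n > 0" and j: "coprime j n" and fin: "finite M" "finite N"
    and inj: "inj_on (\<lambda>s. \<psi> s mod n) N" and N: "card N < n"
    and cong: "[(\<Sum>s\<in>M. (q ^ j) ^ \<phi> s) = (\<Sum>s\<in>N. (q ^ j) ^ \<psi> s)] (mod (q ^ n - 1))"
    and M: "card M \<le> card N \<or> (inj_on (\<lambda>s. \<phi> s mod n) M \<and> card M < n)"
  shows "inj_on (\<lambda>s. \<phi> s mod n) M \<and> (\<lambda>s. \<phi> s mod n) ` M = (\<lambda>s. \<psi> s mod n) ` N"
proof -
  have A: "(j * a) mod n = (j * b) mod n \<longleftrightarrow> a mod n = b mod n" for a b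
    using coprime_mult_mod_cancel[OF j] by (metis mod_mult_right_eq)
  have "inj_on (\<lambda>s. (j * \<psi> s) mod n) N" using inj by (simp add: inj_on_def A)
  moreover have "card M \<le> card N \<or> (inj_on (\<lambda>s. (j * \<phi> s) mod n) M \<and> card M < n)"
    using M by (simp add: inj_on_def A)
  moreover have "[(\<Sum>s\<in>M. q ^ (j * \<phi> s)) = (\<Sum>s\<in>N. q ^ (j * \<psi> s))] (mod (q ^ n - 1))"
    using cong by (simp add: power_mult)
  ultimately have *: "inj_on (\<lambda>s. (j * \<phi> s) mod n) M"
    "(\<lambda>s. (j * \<phi> s) mod n) ` M = (\<lambda>s. (j * \<psi> s) mod n) ` N"
    using power_sums_cong_imp_bij[OF q n fin, of "\<lambda>s. j * \<psi> s" "\<lambda>s. j * \<phi> s"] N by auto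
  have "(\<lambda>s. \<phi> s mod n) ` M = (\<lambda>s. \<psi> s mod n) ` N"
  proof (intro equalityI subsetI)
    fix i assume "i \<in> (\<lambda>s. \<phi> s mod n) ` M"
    then obtain s where s: "s \<in> M" "i = \<phi> s mod n" by auto
    then obtain t where "t \<in> N" "(j * \<phi> s) mod n = (j * \<psi> t) mod n" using *(2) by blast
    with s A show "i \<in> (\<lambda>s. \<psi> s mod n) ` N" by auto
  next
    fix i assume "i \<in> (\<lambda>s. \<psi> s mod n) ` N"
    then obtain s where s: "s \<in> N" "i = \<psi> s mod n" by auto
    then have "(j * \<psi> s) mod n \<in> (\<lambda>s. (j * \<phi> s) mod n) ` M" using *(2) by blast
    then obtain t where "t \<in> M" "(j * \<psi> s) mod n = (j * \<phi> t) mod n" by auto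
    with s A show "i \<in> (\<lambda>s. \<phi> s mod n) ` M" by auto
  qed
  with *(1) show ?thesis by (simp add: inj_on_def A)
qed

section \<open>Power sums over a finite field\<close>

text \<open>Translation by \<open>h\<close> permutes \<open>H\<close>, so the sum over
  \<open>H\<close> is unchanged when \<open>card H\<close> times \<open>h\<close> is added to
  it.\<close>

lemma of_nat_card_closed_under_add:
  fixes H :: "'a::{finite,field} set"
  assumes "\<And>x y. x \<in> H \<Longrightarrow> y \<in> H \<Longrightarrow> x + y \<in> H" and "h \<in> H" "h \<noteq> 0"
  shows "of_nat (card H) = (0::'a)"
proof -
  have "(\<lambda>x. x + h) ` H = H"
    by (intro endo_inj_surj) (use assms in \<open>auto intro!: inj_onI\<close>)
  then have "\<Sum>H = (\<Sum>x\<in>(\<lambda>x. x + h) ` H. x)" by simp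
  also have "\<dots> = (\<Sum>x\<in>H. x + h)" by (subst sum.reindex) (auto intro!: inj_onI)
  also have "\<dots> = \<Sum>H + of_nat (card H) * h" by (simp add: sum.distrib)
  finally show ?thesis using assms(3) by simp
qed

text \<open>Sylow's theorem for the additive group gives a subgroup of order l, and its order
  vanishes in the field.\<close>

lemma prime_dvd_card_field:
  assumes l: "prime l" "l dvd CARD('a::{finite,field})"
  shows "l = CHAR('a)"
proof -
  let ?G = "\<lparr>carrier = UNIV :: 'a set, monoid.mult = (+), one = 0\<rparr>"
  have grp: "group ?G"
  proof (rule groupI)
    fix x assume "x \<in> carrier ?G"
    then show "\<exists>y\<in>carrier ?G. y \<otimes>\<^bsub>?G\<^esub> x = \<one>\<^bsub>?G\<^esub>" by (auto intro!: exI[of _ "- x"])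
  qed (auto simp: add.assoc)
  obtain m where "CARD('a) = l ^ 1 * m" using l(2) by auto
  then obtain H where H: "subgroup H ?G" "card H = l ^ 1"
    using sylow_thm[OF l(1) grp, of 1 m] by (auto simp: Coset.order_def)
  have "card H > 1" using H(2) l(1) prime_gt_1_nat by simp
  then have "\<not> H \<subseteq> {0}" using card_mono[of "{0}" H] by auto
  then obtain h where "h \<in> H" "h \<noteq> 0" by auto
  then have "of_nat (card H) = (0::'a)"
    using subgroup.m_closed[OF H(1)] by (intro of_nat_card_closed_under_add) auto
  then have "CHAR('a) dvd l" using H(2) by (simp add: of_nat_eq_0_iff_char_dvd)
  moreover have "CHAR('a) \<noteq> 1" by simp
  ultimately show ?thesis using l(1) by (auto simp: prime_nat_iff)
qed

lemma card_nonzero: "card (- {0::'a::{finite,zero}}) = CARD('a) - 1"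
  by (simp add: Compl_eq_Diff_UNIV card_Diff_singleton)

lemma power_card_minus_one:
  fixes x :: "'a::{finite,field}"
  assumes "x \<noteq> 0"
  shows "x ^ (CARD('a) - 1) = 1"
proof -
  have "(\<Prod>y\<in>-{0}. x * y) = (\<Prod>y\<in>-{0}. y)"
    by (rule prod.reindex_bij_witness[of _ "\<lambda>y. y / x" "\<lambda>y. x * y"]) (use assms in auto)
  moreover have "(\<Prod>y\<in>-{0}. x * y) = x ^ (CARD('a) - 1) * (\<Prod>y\<in>-{0}. y)"
    by (simp add: prod.distrib card_nonzero)
  moreover have "(\<Prod>y\<in>-{0::'a}. y) \<noteq> 0" by simp
  ultimately show ?thesis by simp
qed

lemma card_roots_power_le:
  fixes c :: "'a::{finite,field}"
  assumes "k > 0"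
  shows "card {x. x ^ k = c} \<le> k"
proof -
  let ?p = "monom 1 k - [:c:]"
  have deg: "degree ?p = k"
    using assms by (subst diff_conv_add_uminus, subst degree_add_eq_left) (auto simp: degree_monom_eq)
  then have "?p \<noteq> 0" using assms by auto
  moreover have "{x. poly ?p x = 0} = {x. x ^ k = c}" by (auto simp: poly_monom)
  ultimately show ?thesis using card_poly_roots_bound[of ?p] deg by simp
qed

section \<open>Frobenius powers and orthogonality of power functions\<close>

locale finite_field_extension =
  fixes q n :: nat and F :: "'a::{finite,field} itself"
  assumes card_field: "CARD('a) = q ^ n" and n_ge_2: "n \<ge> 2"
begin

lemma q_ge_2: "q \<ge> 2"
proof -
  have "card {0, 1::'a} \<le> CARD('a)" by (rule card_mono) auto
  then have "2 \<le> q ^ n" using card_field by simp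
  then have "q \<noteq> 1" and "q \<noteq> 0" using n_ge_2 by (auto simp: power_0_left intro: ccontr)
  then show ?thesis by simp
qed

lemma n_pos: "n > 0" using n_ge_2 by simp

lemma CHAR_prime: "prime CHAR('a)"
  by (intro prime_CHAR_semidom finite_imp_CHAR_pos) auto

text \<open>Any prime divisor of q divides the order of the field and so equals the characteristic;
  hence the part of q prime to the characteristic is 1.\<close>

lemma q_eq_CHAR_power: "\<exists>k. q = CHAR('a) ^ k"
proof -
  have "\<not> is_unit CHAR('a)" using CHAR_prime not_prime_unit by blast
  then obtain m where m: "q = CHAR('a) ^ multiplicity CHAR('a) q * m" "\<not> CHAR('a) dvd m"
    using multiplicity_decompose'[of q "CHAR('a)"] q_ge_2 by auto
  have "m = 1"
  proof (rule ccontr)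
    assume "m \<noteq> 1"
    then obtain l where l: "prime l" "l dvd m" using prime_factor_nat by blast
    then have "l dvd q" using m(1) by (metis dvd_mult)
    then have "l dvd CARD('a)" using card_field n_pos by (simp add: dvd_power_iff_le dvd_trans[OF _ dvd_power])
    then show False using prime_dvd_card_field[OF l(1)] l(2) m(2) by blast
  qed
  with m(1) show ?thesis by (metis mult.right_neutral)
qed

lemma frobenius_add: "(x + y :: 'a) ^ (q ^ k) = x ^ (q ^ k) + y ^ (q ^ k)"
proof -
  obtain l where "q = CHAR('a) ^ l" using q_eq_CHAR_power by blast
  then have "q ^ k = CHAR('a) ^ (l * k)" by (simp add: power_mult)
  then show ?thesis by (rule freshmans_dream'[OF CHAR_prime])
qed

lemma q_power_pos [simp]: "q ^ k > 0" using q_ge_2 by simp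

lemma zero_frobenius [simp]: "(0::'a) ^ (q ^ k) = 0" "(0::'a) ^ ((q ^ j) ^ k) = 0"
  using q_ge_2 by simp_all

lemma frobenius_additive: "additive (\<lambda>x::'a. x ^ (q ^ k))"
  by standard (rule frobenius_add)

lemma frobenius_sum: "(\<Sum>i\<in>A. g i :: 'a) ^ (q ^ k) = (\<Sum>i\<in>A. g i ^ (q ^ k))"
  using additive.sum[OF frobenius_additive] .

lemma frobenius_eq_0_iff: "(x::'a) ^ (q ^ k) = 0 \<longleftrightarrow> x = 0"
  using q_power_pos[of k] by simp

lemma power_card_unit: "x \<noteq> 0 \<Longrightarrow> (x::'a) ^ (q ^ n - 1) = 1"
  using power_card_minus_one[of x] card_field by simp

lemma power_cong:
  assumes "[e = d] (mod (q ^ n - 1))" "(x::'a) \<noteq> 0"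
  shows "x ^ e = x ^ d"
proof -
  have "x ^ e = x ^ (e mod (q ^ n - 1))" for e
  proof -
    have "x ^ e = x ^ ((q ^ n - 1) * (e div (q ^ n - 1)) + e mod (q ^ n - 1))" by simp
    also have "\<dots> = x ^ (e mod (q ^ n - 1))"
      by (simp only: power_add power_mult power_card_unit[OF assms(2)]) simp
    finally show ?thesis .
  qed
  with assms(1) show ?thesis unfolding cong_def by metis
qed

lemma frobenius_mod: "(x::'a) ^ (q ^ k) = x ^ (q ^ (k mod n))"
proof (cases "x = 0")
  case False
  then show ?thesis using power_cong_mod_exponent[of q k n] q_ge_2 by (intro power_cong) auto
qed simp

lemma card_field_gt_1: "q ^ n > 1"
  using q_ge_2 n_pos one_less_power[of q n] by simp

lemma of_nat_card_units: "of_nat (q ^ n - 1) = (- 1 :: 'a)"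
proof -
  have "of_nat (card (UNIV::'a set)) = (0::'a)"
    by (rule of_nat_card_closed_under_add[of _ 1]) auto
  then show ?thesis using card_field card_field_gt_1 by (simp add: of_nat_diff)
qed

text \<open>Orthogonality of the characters of the multiplicative group. Congruent exponents make
  each of the q^n - 1 summands 1; otherwise scaling x by some y with y^e different from y^d
  multiplies the sum by a factor other than 1. The quotient form keeps the exponents natural
  numbers.\<close>

lemma sum_power_quotient:
  "(\<Sum>x\<in>-{0::'a}. x ^ e / x ^ d) = (if [e = d] (mod (q ^ n - 1)) then - 1 else 0)"
proof (cases "[e = d] (mod (q ^ n - 1))")
  case True
  have "(\<Sum>x\<in>-{0::'a}. x ^ e / x ^ d) = (\<Sum>x\<in>-{0::'a}. 1)"
    by (rule sum.cong) (use power_cong[OF True] in auto)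
  also have "\<dots> = of_nat (q ^ n - 1)" by (simp add: card_nonzero card_field)
  finally show ?thesis using True of_nat_card_units by simp
next
  case False
  let ?N = "q ^ n - 1"
  \<comment> \<open>Otherwise all q^n - 1 units would be roots of y^(d - e) = 1, an equation of
    smaller degree.\<close>
  have ex: "\<exists>y::'a. y \<noteq> 0 \<and> y ^ e \<noteq> y ^ d" if "e < d" "d < ?N" for e d
  proof (rule ccontr)
    assume *: "\<not> ?thesis"
    have "y ^ (d - e) = 1" if "y \<noteq> 0" for y :: 'a
    proof -
      have "y ^ e = y ^ d" using * that by blast
      then show ?thesis using that \<open>e < d\<close> by (simp add: power_diff)
    qed
    then have "-{0} \<subseteq> {y::'a. y ^ (d - e) = 1}" by auto
    then have "card (-{0::'a}) \<le> card {y::'a. y ^ (d - e) = 1}" by (intro card_mono) auto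
    also have "\<dots> \<le> d - e" by (rule card_roots_power_le) (use that in simp)
    finally show False using that by (simp add: card_nonzero card_field)
  qed
  have "\<exists>y::'a. y \<noteq> 0 \<and> y ^ e \<noteq> y ^ d"
  proof -
    have N: "?N > 0" using card_field_gt_1 by simp
    have "e mod ?N < d mod ?N \<or> d mod ?N < e mod ?N"
      using False by (auto simp: cong_def)
    then obtain y :: 'a where y: "y \<noteq> 0" "y ^ (e mod ?N) \<noteq> y ^ (d mod ?N)"
      using ex[of "e mod ?N" "d mod ?N"] ex[of "d mod ?N" "e mod ?N"] N by fastforce
    moreover have "y ^ (k mod ?N) = y ^ k" for k by (rule power_cong) (use y in auto)
    ultimately show ?thesis by metis
  qed
  then obtain y :: 'a where y: "y \<noteq> 0" "y ^ e \<noteq> y ^ d" by blast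
  let ?S = "\<Sum>x\<in>-{0::'a}. x ^ e / x ^ d"
  have "?S = (\<Sum>x\<in>-{0::'a}. (y * x) ^ e / (y * x) ^ d)"
    by (rule sum.reindex_bij_witness[of _ "\<lambda>x. y * x" "\<lambda>x. x / y"]) (use y in auto)
  also have "\<dots> = (y ^ e / y ^ d) * ?S"
    by (simp add: power_mult_distrib sum_distrib_left)
  finally have "?S * (1 - y ^ e / y ^ d) = 0" by (simp add: algebra_simps)
  moreover have "1 - y ^ e / y ^ d \<noteq> 0" using y by auto
  ultimately have "?S = 0" by (simp only: mult_eq_0_iff simp_thms)
  with False show ?thesis by simp
qed

lemma card_base_field: "card (subfield_of_order q :: 'a set) = q"
proof (rule antisym)
  let ?p = "monom 1 q - [:0, 1 :: 'a:]"
  have deg: "degree ?p = q"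
    using q_ge_2 by (subst diff_conv_add_uminus, subst degree_add_eq_left) (auto simp: degree_monom_eq)
  then have "?p \<noteq> 0" using q_ge_2 by auto
  moreover have "{x. poly ?p x = 0} = subfield_of_order q"
    by (auto simp: poly_monom subfield_of_order_def)
  ultimately show "card (subfield_of_order q :: 'a set) \<le> q"
    using card_poly_roots_bound[of ?p] deg by simp
next
  \<comment> \<open>x^e is the norm to the base field. It sends units to nonzero solutions of c^q =
    c, and its fibres have at most e elements, so at least q - 1 values occur.\<close>
  define e where "e = (\<Sum>i<n. q ^ i)"
  have e: "(q - 1) * e = q ^ n - 1"
    using repunit_sum[of q n] q_ge_2 by (simp add: e_def sum_distrib_left)
  have e_pos: "e > 0" using e card_field_gt_1 by (cases "e = 0") auto
  let ?K = "subfield_of_order q - {0} :: 'a set"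
  have "- {0::'a} \<subseteq> (\<Union>c\<in>?K. {x. x ^ e = c})"
  proof
    fix x :: 'a assume "x \<in> - {0}"
    then have x: "x \<noteq> 0" by simp
    have "(x ^ e) ^ q = (x ^ e) ^ (q - 1) * x ^ e" using q_ge_2 by (simp flip: power_Suc2)
    also have "(x ^ e) ^ (q - 1) = 1"
      using power_card_unit[OF x] e by (simp flip: power_mult add: mult.commute)
    finally have "x ^ e \<in> ?K" using x by (simp add: subfield_of_order_def)
    then show "x \<in> (\<Union>c\<in>?K. {x. x ^ e = c})" by blast
  qed
  then have "card (- {0::'a}) \<le> card (\<Union>c\<in>?K. {x. x ^ e = c})" by (intro card_mono) auto
  also have "\<dots> \<le> (\<Sum>c\<in>?K. card {x. x ^ e = c})" by (rule card_UN_le) auto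
  also have "\<dots> \<le> (\<Sum>c\<in>?K. e)" by (intro sum_mono card_roots_power_le e_pos)
  finally have "q ^ n - 1 \<le> card ?K * e" by (simp add: card_nonzero card_field)
  then have "(q - 1) * e \<le> card ?K * e" by (simp only: e)
  then have "q - 1 \<le> card ?K" using e_pos by (simp only: mult_le_cancel2)
  moreover have "card ?K = card (subfield_of_order q :: 'a set) - 1"
    using q_ge_2 by (subst card_Diff_singleton) (auto simp: subfield_of_order_def)
  moreover have "card (subfield_of_order q :: 'a set) > 0"
    using q_ge_2 by (auto simp: card_gt_0_iff subfield_of_order_def intro: exI[of _ 0])
  ultimately show "q \<le> card (subfield_of_order q :: 'a set)" by linarith
qed

text \<open>Some iterate of x -> x^(q^j) is x -> x^q, because j is invertible modulo n.\<close>

lemma fixed_by_conjugation: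
  assumes "coprime j n" "(c::'a) ^ (q ^ j) = c"
  shows "c ^ q = c"
proof -
  obtain u where u: "[j * u = 1] (mod n)" using cong_solve_coprime_nat[OF assms(1)] by auto
  have "c ^ (q ^ (j * k)) = c" for k
    by (induction k) (use assms(2) in \<open>simp_all add: power_add power_mult\<close>)
  then have "c = c ^ (q ^ ((j * u) mod n))" using frobenius_mod[of c "j * u"] by simp
  also have "(j * u) mod n = 1" using u n_ge_2 by (simp add: cong_def)
  finally show ?thesis by simp
qed

lemma conjugate_cong_iff:
  assumes "coprime j n"
  shows "[(q ^ j) ^ a = (q ^ j) ^ b] (mod (q ^ n - 1)) \<longleftrightarrow> a mod n = b mod n"
proof
  assume "[(q ^ j) ^ a = (q ^ j) ^ b] (mod (q ^ n - 1))"
  then show "a mod n = b mod n"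
    using conjugate_sums_cong_imp_bij[OF q_ge_2 n_pos assms, of "{()}" "{()}" "\<lambda>_. b" "\<lambda>_. a"] n_ge_2
    by simp
next
  assume "a mod n = b mod n"
  then have "(j * a) mod n = (j * b) mod n" by (metis mod_mult_right_eq)
  then show "[(q ^ j) ^ a = (q ^ j) ^ b] (mod (q ^ n - 1))"
    using power_cong_mod_exponent[of q "j * a" n] power_cong_mod_exponent[of q "j * b" n] q_ge_2
    by (simp add: cong_def power_mult)
qed

text \<open>The coefficient of x^(\<sigma>^i), with \<sigma> = q^j, when a base-linear f is written
  as a polynomial in the conjugates of x. Division by l^(\<sigma>^i) isolates it by orthogonality,
  and the sign cancels the value -1 of the surviving sum.\<close>

definition conj_coeff :: "nat \<Rightarrow> nat \<Rightarrow> ('a \<Rightarrow> 'a) \<Rightarrow> 'a" where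
  "conj_coeff j i f = - (\<Sum>l\<in>-{0}. f l / l ^ ((q ^ j) ^ i))"

text \<open>The coefficients are read off by duality: with \<open>Tr y = \<Sum>\<^sub>i y\<^bsup>\<sigma>^i\<^esup>\<close>, which has values in
  the base field, linearity turns \<open>\<Sum>\<^sub>l f (x l) Tr (1/l)\<close> into \<open>f (x \<cdot> \<Sum>\<^sub>l l Tr (1/l)) = f (- x)\<close>.\<close>

lemma base_linear_expansion:
  fixes f :: "'a \<Rightarrow> 'a"
  assumes j: "coprime j n" and f: "additive f" and lin: "\<And>c x. c ^ q = c \<Longrightarrow> f (c * x) = c * f x"
  shows "f x = (\<Sum>i<n. conj_coeff j i f * x ^ ((q ^ j) ^ i))"
proof -
  define Tr where "Tr y = (\<Sum>i<n. y ^ ((q ^ j) ^ i))" for y :: 'a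
  have Tr_fix: "Tr y ^ q = Tr y" for y
  proof (rule fixed_by_conjugation[OF j])
    \<comment> \<open>Raising to the power q^j shifts the conjugates by one; the last becomes
      y^(\<sigma>^n) = y, so they are only permuted cyclically.\<close>
    have "Tr y ^ (q ^ j) = (\<Sum>i<n. y ^ ((q ^ j) ^ Suc i))"
      by (simp add: Tr_def frobenius_sum power_mult mult.commute flip: power_mult)
    also have "\<dots> + y ^ ((q ^ j) ^ 0) = (\<Sum>i<Suc n. y ^ ((q ^ j) ^ i))"
      by (subst sum.lessThan_Suc_shift) simp
    also have "\<dots> = Tr y + y ^ ((q ^ j) ^ n)" by (simp add: Tr_def)
    also have "y ^ ((q ^ j) ^ n) = y"
      using frobenius_mod[of y "j * n"] by (simp add: power_mult)
    finally show "Tr y ^ (q ^ j) = Tr y" by simp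
  qed
  have "(\<Sum>i<n. conj_coeff j i f * x ^ ((q ^ j) ^ i)) = - (\<Sum>i<n. \<Sum>l\<in>-{0}. f l * (x / l) ^ ((q ^ j) ^ i))"
    by (simp add: conj_coeff_def sum_negf sum_distrib_right power_divide)
  also have "(\<Sum>i<n. \<Sum>l\<in>-{0}. f l * (x / l) ^ ((q ^ j) ^ i)) = (\<Sum>l\<in>-{0}. f l * Tr (x / l))"
    by (subst sum.swap) (simp add: Tr_def sum_distrib_left)
  also have "- \<dots> = f x"
  proof (cases "x = 0")
    case True
    have "Tr 0 = 0" using q_ge_2 by (simp add: Tr_def)
    with True show ?thesis using additive.zero[OF f] by simp
  next
    case False
    have "(\<Sum>l\<in>-{0}. f l * Tr (x / l)) = (\<Sum>l\<in>-{0}. f (x * l) * Tr (1 / l))"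
      by (rule sum.reindex_bij_witness[of _ "\<lambda>l. x * l" "\<lambda>l. l / x"]) (use False in auto)
    also have "\<dots> = (\<Sum>l\<in>-{0}. f (Tr (1 / l) * (x * l)))"
      by (intro sum.cong refl) (simp add: lin[OF Tr_fix])
    also have "\<dots> = f (\<Sum>l\<in>-{0}. Tr (1 / l) * (x * l))" by (simp add: additive.sum[OF f])
    also have "(\<Sum>l\<in>-{0}. Tr (1 / l) * (x * l)) = x * (\<Sum>i<n. \<Sum>l\<in>-{0}. l ^ 1 / l ^ ((q ^ j) ^ i))"
      by (subst sum.swap) (simp add: Tr_def sum_distrib_left sum_distrib_right power_divide mult_ac)
    also have "(\<Sum>i<n. \<Sum>l\<in>-{0}. l ^ 1 / l ^ ((q ^ j) ^ i)) = (\<Sum>i<n. if i = 0 then - 1 else (0::'a))"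
    proof (rule sum.cong[OF refl])
      fix i assume "i \<in> {..<n}"
      then have "[1 = (q ^ j) ^ i] (mod (q ^ n - 1)) \<longleftrightarrow> i = 0"
        using conjugate_cong_iff[OF j, of 0 i] by auto
      then show "(\<Sum>l\<in>-{0::'a}. l ^ 1 / l ^ ((q ^ j) ^ i)) = (if i = 0 then - 1 else 0)"
        by (simp only: sum_power_quotient)
    qed
    also have "\<dots> = - 1" using n_pos by (simp add: sum.delta)
    finally show ?thesis using additive.minus[OF f, of x] by simp
  qed
  finally show ?thesis ..
qed

text \<open>Each fibre of \<open>x \<mapsto> f x / x\<close> is a nonzero additive group without its zero, so its
  size is \<open>-1\<close> in the field: multiplicities do not matter.\<close>

lemma direction_power_sums:
  fixes f h :: "'a \<Rightarrow> 'a"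
  assumes "additive f" "additive h"
    and dir: "\<And>b. (\<exists>x. x \<noteq> 0 \<and> f x = b * x) \<longleftrightarrow> (\<exists>x. x \<noteq> 0 \<and> h x = b * x)"
  shows "(\<Sum>x\<in>-{0}. (f x / x) ^ B) = (\<Sum>x\<in>-{0}. (h x / x) ^ B)"
proof -
  have fibres: "(\<Sum>x\<in>-{0}. (f x / x) ^ B) = (\<Sum>b\<in>UNIV. b ^ B * (if \<exists>x. x \<noteq> 0 \<and> f x = b * x then - 1 else 0))"
    if f: "additive f" for f :: "'a \<Rightarrow> 'a"
  proof -
    have "(\<Sum>x\<in>-{0}. (f x / x) ^ B) = (\<Sum>b\<in>UNIV. \<Sum>x | x \<in> -{0} \<and> f x / x = b. (f x / x) ^ B)"
      by (rule sum.group[symmetric]) auto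
    also have "\<dots> = (\<Sum>b\<in>UNIV. b ^ B * of_nat (card {x. x \<noteq> 0 \<and> f x = b * x}))"
    proof (rule sum.cong[OF refl])
      fix b
      have "(\<Sum>x | x \<in> -{0} \<and> f x / x = b. (f x / x) ^ B) = (\<Sum>x | x \<noteq> 0 \<and> f x = b * x. b ^ B)"
        by (rule sum.cong) (auto simp: field_simps)
      then show "(\<Sum>x | x \<in> -{0} \<and> f x / x = b. (f x / x) ^ B) = b ^ B * of_nat (card {x. x \<noteq> 0 \<and> f x = b * x})"
        by simp
    qed
    also have "\<dots> = (\<Sum>b\<in>UNIV. b ^ B * (if \<exists>x. x \<noteq> 0 \<and> f x = b * x then - 1 else 0))"
    proof (rule sum.cong[OF refl])
      fix b
      let ?H = "{x. f x = b * x}"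
      have "of_nat (card {x. x \<noteq> 0 \<and> f x = b * x}) = (if \<exists>x. x \<noteq> 0 \<and> f x = b * x then - 1 else (0::'a))"
      proof (cases "\<exists>x. x \<noteq> 0 \<and> f x = b * x")
        case True
        then have "of_nat (card ?H) = (0::'a)"
          by (auto intro!: of_nat_card_closed_under_add simp: additive.add[OF f] distrib_left)
        moreover have "{x. x \<noteq> 0 \<and> f x = b * x} = ?H - {0}" by auto
        moreover have "0 \<in> ?H" using additive.zero[OF f] by simp
        moreover from calculation have "card ?H > 0" by (auto simp: card_gt_0_iff simp del: mem_Collect_eq)
        ultimately show ?thesis using True by (simp add: of_nat_diff)
      next
        case False
        then have "{x. x \<noteq> 0 \<and> f x = b * x} = {}" by auto
        then show ?thesis using False by (simp only: card.empty of_nat_0 if_False)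
      qed
      then show "b ^ B * of_nat (card {x. x \<noteq> 0 \<and> f x = b * x}) = b ^ B * (if \<exists>x. x \<noteq> 0 \<and> f x = b * x then - 1 else 0)"
        by simp
    qed
    finally show ?thesis .
  qed
  show ?thesis unfolding fibres[OF assms(1)] fibres[OF assms(2)] dir ..
qed

end

section \<open>Subspaces defining a linear set of pseudoregulus type\<close>

definition zero_sum_mod :: "nat \<Rightarrow> nat set \<Rightarrow> nat list \<Rightarrow> bool" where
  "zero_sum_mod n S xs \<longleftrightarrow> xs \<noteq> [] \<and> set xs \<subseteq> S \<and> n dvd sum_list xs"

text \<open>A zero-sum list is the step sequence of a closed walk on Z/n, and \<open>p k\<close> is
  the vertex reached from 0 after k steps.\<close>

context
  fixes n :: nat and S :: "nat set" and xs :: "nat list" and p :: "nat \<Rightarrow> nat"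
  assumes zero_sum: "zero_sum_mod n S xs"
    and shortest: "\<And>ys. zero_sum_mod n S ys \<Longrightarrow> length xs \<le> length ys"
  defines "p \<equiv> \<lambda>k. sum_list (take k xs)"
begin

lemma sum_list_take_drop: "k \<le> l \<Longrightarrow> p l = p k + sum_list (take (l - k) (drop k xs))"
  using take_add[of k "l - k" xs] by (simp add: p_def)

lemma partial_sum_Suc: "k < length xs \<Longrightarrow> p (Suc k) = p k + xs ! k"
  by (simp add: p_def take_Suc_conv_app_nth)

lemma partial_sum_length: "n dvd p (length xs)"
  using zero_sum by (simp add: p_def zero_sum_mod_def)

lemma set_take_drop: "set (take i (drop k xs)) \<subseteq> S"
  using zero_sum by (auto simp: zero_sum_mod_def dest: in_set_takeD in_set_dropD)

text \<open>A repeated vertex would cut out a shorter closed walk.\<close>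

lemma partial_sums_mod_neq:
  assumes "k < l" "l < length xs"
  shows "p k mod n \<noteq> p l mod n"
proof
  assume "p k mod n = p l mod n"
  then have "[p k + 0 = p k + sum_list (take (l - k) (drop k xs))] (mod n)"
    using sum_list_take_drop[of k l] assms by (simp add: cong_def)
  then have "n dvd sum_list (take (l - k) (drop k xs))"
    unfolding cong_add_lcancel_nat using cong_0_iff cong_sym by blast
  then have "zero_sum_mod n S (take (l - k) (drop k xs))"
    using assms set_take_drop by (auto simp: zero_sum_mod_def)
  from shortest[OF this] show False using assms by simp
qed

lemma partial_sums_distinct: "inj_on (\<lambda>k. p k mod n) {..<length xs}"
  using partial_sums_mod_neq by (intro linorder_inj_onI) (auto simp: eq_commute)

text \<open>A chord of the closed walk \<open>p\<close> in the Cayley digraph of \<open>\<int>/n\<close> would shorten it.\<close>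

lemma shortest_zero_sum_no_chord:
  assumes kl: "k < length xs" "l < length xs" and s: "s \<in> S" and chord: "(s + p k) mod n = p l mod n"
  shows "s mod n = (xs ! k) mod n"
proof -
  have "(s + p k) mod n = p (Suc k) mod n"
  proof (cases "l \<le> k")
    case True
    \<comment> \<open>A backward chord closes the segment from vertex l to vertex k into a closed
      walk of k - l + 1 steps. Minimality leaves only l = 0 and k the last index, where the chord
      ends where the final step ends.\<close>
    let ?ys = "s # take (k - l) (drop l xs)"
    have "[p l + sum_list ?ys = p l + 0] (mod n)"
      using chord sum_list_take_drop[OF True] by (simp add: cong_def ac_simps)
    then have "n dvd sum_list ?ys" unfolding cong_add_lcancel_nat using cong_0_iff by blast
    then have "zero_sum_mod n S ?ys" using s set_take_drop by (auto simp: zero_sum_mod_def)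
    from shortest[OF this] have "l = 0" "Suc k = length xs" using kl True by auto
    then show ?thesis using chord partial_sum_length by (simp add: p_def)
  next
    case False
    \<comment> \<open>A forward chord replaces the l - k steps between its ends by a single one, so
      minimality gives l = k + 1.\<close>
    let ?ys = "take k xs @ s # drop l xs"
    have tot: "p (length xs) = p l + sum_list (drop l xs)"
      using sum_list_take_drop[of l "length xs"] kl by simp
    have "[p k + s + sum_list (drop l xs) = p l + sum_list (drop l xs)] (mod n)"
      using chord by (intro cong_add cong_refl) (simp add: cong_def ac_simps)
    then have "n dvd sum_list ?ys"
      using partial_sum_length tot by (simp add: cong_def p_def dvd_eq_mod_eq_0 ac_simps)
    then have "zero_sum_mod n S ?ys"
      using s set_take_drop[of k 0] set_take_drop[of "length xs" l] by (auto simp: zero_sum_mod_def)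
    from shortest[OF this] have "l = Suc k" using kl False by auto
    then show ?thesis using chord by simp
  qed
  then have "[p k + s = p k + xs ! k] (mod n)"
    using partial_sum_Suc[OF kl(1)] by (simp add: cong_def ac_simps)
  then show ?thesis unfolding cong_add_lcancel_nat by (simp add: cong_def)
qed

end

text \<open>The set contains all multiples of j, and these exhaust the residues modulo n.\<close>

lemma coprime_shift_invariant_card:
  fixes j n :: nat
  assumes j: "coprime j n" and n: "n > 0" and I: "0 \<in> I" "I \<subseteq> {..<n}"
    and shift: "\<And>i. i \<in> I \<Longrightarrow> (j + i) mod n \<in> I"
  shows "card I = n"
proof -
  have mult: "(j * i) mod n \<in> I" for i
  proof (induction i)
    case (Suc i)
    from shift[OF this] show ?case by (simp add: mod_add_right_eq)
  qed (use I in simp)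
  have "{..<n} \<subseteq> I"
  proof
    fix r assume r: "r \<in> {..<n}"
    obtain u where u: "[j * u = 1] (mod n)" using cong_solve_coprime_nat[OF j] by auto
    then have "[j * u * r = 1 * r] (mod n)" by (intro cong_mult cong_refl)
    then have "(j * (u * r)) mod n = r" using r by (simp add: cong_def mult.assoc)
    with mult[of "u * r"] show "r \<in> I" by simp
  qed
  with I(2) have "I = {..<n}" by blast
  then show ?thesis by simp
qed

text \<open>A step s repeated n / gcd(s, n) times closes up, so s must be coprime to n. Then any
  step s' is completed to zero by k < n copies of s, and k + 1 >= n leaves k = n - 1, that is s' =
  s.\<close>

lemma long_zero_sums_imp_singleton:
  fixes n :: nat
  assumes n: "n \<ge> 2" and S: "S \<subseteq> {..<n}" "S \<noteq> {}"
    and long: "\<And>ys. zero_sum_mod n S ys \<Longrightarrow> n \<le> length ys"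
  obtains s where "S = {s}" "coprime s n" "s < n"
proof -
  obtain s where s: "s \<in> S" using S by blast
  have cop: "coprime s n"
  proof (rule ccontr)
    assume "\<not> coprime s n"
    define g where "g = gcd s n"
    have g: "g dvd n" "g dvd s" by (simp_all add: g_def)
    have "g \<noteq> 1" using \<open>\<not> coprime s n\<close> unfolding g_def coprime_iff_gcd_eq_1 .
    moreover have "g \<noteq> 0" using n by (simp add: g_def)
    ultimately have g1: "g > 1" by simp
    obtain n' s' where "n = g * n'" "s = g * s'" using g by (meson dvdE)
    moreover have "n' > 0" "n' < n" using calculation g1 n by (auto intro!: gr0I)
    moreover have "sum_list (replicate n' s) = n * s'"
      using calculation by (simp add: sum_list_replicate)
    ultimately have "zero_sum_mod n S (replicate n' s)" and "n' < n"
      using s by (auto simp: zero_sum_mod_def)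
    from long[OF this(1)] this(2) show False by simp
  qed
  have "s' = s" if s': "s' \<in> S" for s'
  proof -
    obtain u where u: "[s * u = 1] (mod n)" using cong_solve_coprime_nat[OF cop] by auto
    \<comment> \<open>k is -s'/s modulo n.\<close>
    define k where "k = (u * (n - s')) mod n"
    have "[s * k = s * (u * (n - s'))] (mod n)"
      by (simp add: k_def cong_def mod_mult_right_eq)
    also have "s * (u * (n - s')) = s * u * (n - s')" by simp
    also have "[\<dots> = 1 * (n - s')] (mod n)" using u by (intro cong_mult cong_refl)
    finally have "[s' + s * k = s' + 1 * (n - s')] (mod n)" by (intro cong_add cong_refl)
    moreover have "s' + 1 * (n - s') = n" using s' S by auto
    ultimately have dvd: "n dvd s' + s * k" by (simp add: cong_def dvd_eq_mod_eq_0)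
    then have "zero_sum_mod n S (s' # replicate k s)"
      using s s' by (auto simp: zero_sum_mod_def sum_list_replicate mult.commute)
    from long[OF this] have "n \<le> Suc k" by simp
    moreover have "k < n" using n by (simp add: k_def)
    ultimately have "n = Suc k" by linarith
    then have "s * k + s = n * s" by simp
    then have "[s * k + s' = s * k + s] (mod n)"
      using dvd by (simp add: cong_def dvd_eq_mod_eq_0 add.commute)
    then show ?thesis
      unfolding cong_add_lcancel_nat using s s' S cong_less_modulus_unique_nat by blast
  qed
  with s have "S = {s}" by blast
  then show ?thesis using that cop s S by auto
qed

section \<open>Power sums that detect monomials\<close>

context finite_field_extension
begin

text \<open>Expanding the power chooses a summand \<open>\<phi> k\<close> of f for each k. The sum
  over x keeps the choices for which \<open>\<phi> k + p k\<close> runs again through the vertices;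
  if all chosen coefficients are nonzero, the absence of chords leaves only the walk itself. A
  single nonzero product of conjugated coefficients remains.\<close>

lemma power_sum_nonzero_of_shortest_zero_sum:
  fixes f :: "'a \<Rightarrow> 'a" and xs :: "nat list" and a :: "nat \<Rightarrow> 'a"
  defines "p \<equiv> \<lambda>k. sum_list (take k xs)"
  assumes f: "\<And>x. f x = (\<Sum>i<n. a i * x ^ (q ^ i))"
    and S: "S = {i. i < n \<and> a i \<noteq> 0}"
    and xs: "zero_sum_mod n S xs"
    and shortest: "\<And>ys. zero_sum_mod n S ys \<Longrightarrow> length xs \<le> length ys"
    and short: "length xs < n"
  shows "(\<Sum>x\<in>-{0}. (f x / x) ^ (\<Sum>k<length xs. q ^ p k)) \<noteq> 0"
proof -
  let ?m = "length xs"
  define B where "B = (\<Sum>k<?m. q ^ p k)"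
  define \<Phi> where "\<Phi> = PiE {..<?m} (\<lambda>_. {..<n})"
  define c where "c \<phi> = (\<Prod>k<?m. a (\<phi> k) ^ (q ^ p k))" for \<phi>
  define \<phi>0 where "\<phi>0 = restrict ((!) xs) {..<?m}"
  have xsS: "xs ! k \<in> S" if "k < ?m" for k
    using xs that unfolding zero_sum_mod_def by (meson nth_mem subsetD)
  have fin: "finite \<Phi>" unfolding \<Phi>_def by (intro finite_PiE) auto
  have expand: "(f x / x) ^ B = (\<Sum>\<phi>\<in>\<Phi>. c \<phi> * (x ^ (\<Sum>k<?m. q ^ (\<phi> k + p k)) / x ^ B))" for x
  proof -
    have "(f x / x) ^ B = (\<Prod>k<?m. (f x / x) ^ (q ^ p k))" by (simp add: B_def power_sum)
    also have "\<dots> = (\<Prod>k<?m. \<Sum>i<n. a i ^ (q ^ p k) * (x ^ (q ^ (i + p k)) / x ^ (q ^ p k)))"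
      by (simp add: f power_divide frobenius_sum power_mult_distrib sum_divide_distrib
          power_add flip: power_mult)
    also have "\<dots> = (\<Sum>\<phi>\<in>\<Phi>. \<Prod>k<?m. a (\<phi> k) ^ (q ^ p k) * (x ^ (q ^ (\<phi> k + p k)) / x ^ (q ^ p k)))"
      unfolding \<Phi>_def by (rule prod_sum_PiE) auto
    also have "\<dots> = (\<Sum>\<phi>\<in>\<Phi>. c \<phi> * (x ^ (\<Sum>k<?m. q ^ (\<phi> k + p k)) / x ^ B))"
      by (simp add: c_def B_def prod.distrib prod_dividef power_sum)
    finally show ?thesis .
  qed
  define t where "t \<phi> = c \<phi> * (if [(\<Sum>k<?m. q ^ (\<phi> k + p k)) = B] (mod (q ^ n - 1)) then - 1 else 0)" for \<phi>
  have "(\<Sum>x\<in>-{0}. (f x / x) ^ B) = (\<Sum>\<phi>\<in>\<Phi>. t \<phi>)"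
    unfolding expand by (subst sum.swap) (simp only: t_def[abs_def] sum_power_quotient flip: sum_distrib_left)
  also have "\<dots> = (\<Sum>\<phi>\<in>{\<phi>0}. t \<phi>)"
  proof (rule sum.mono_neutral_right[OF fin])
    show "{\<phi>0} \<subseteq> \<Phi>"
      using xsS by (auto simp: \<phi>0_def \<Phi>_def S)
    show "\<forall>\<phi>\<in>\<Phi> - {\<phi>0}. t \<phi> = 0"
    proof (intro ballI, rule ccontr)
      fix \<phi> assume \<phi>: "\<phi> \<in> \<Phi> - {\<phi>0}" and t: "t \<phi> \<noteq> 0"
      have supp: "\<phi> k \<in> S" if "k < ?m" for k
      proof -
        have "c \<phi> \<noteq> 0" using t by (auto simp: t_def)
        then have "a (\<phi> k) ^ (q ^ p k) \<noteq> 0" using that by (auto simp: c_def)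
        then have "a (\<phi> k) \<noteq> 0" by (simp only: frobenius_eq_0_iff simp_thms)
        moreover have "\<phi> k < n" using \<phi> that by (auto simp: \<Phi>_def)
        ultimately show ?thesis by (simp add: S)
      qed
      have "[(\<Sum>k<?m. q ^ (\<phi> k + p k)) = (\<Sum>k<?m. q ^ p k)] (mod (q ^ n - 1))"
        using t by (auto simp: t_def B_def split: if_splits)
      \<comment> \<open>Both sums have the same number of terms and the vertices \<open>p k\<close>
        are distinct, so the shifted exponents permute the vertices modulo n.\<close>
      then have im: "(\<lambda>k. (\<phi> k + p k) mod n) ` {..<?m} = (\<lambda>k. p k mod n) ` {..<?m}"
        using power_sums_cong_imp_bij[OF q_ge_2 n_pos, of "{..<?m}" "{..<?m}" p "\<lambda>k. \<phi> k + p k"]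
          partial_sums_distinct[OF xs shortest] short by (auto simp: p_def)
      have "\<phi> k = xs ! k" if k: "k < ?m" for k
      proof -
        obtain l where l: "l < ?m" "(\<phi> k + p k) mod n = p l mod n" using im k by (auto simp: set_eq_iff)
        have "\<phi> k mod n = (xs ! k) mod n"
          using shortest_zero_sum_no_chord[OF xs shortest k l(1) supp[OF k]] l(2) by (simp add: p_def)
        moreover have "\<phi> k < n" using supp[OF k] by (simp add: S)
        moreover have "xs ! k < n" using xsS[OF k] by (simp add: S)
        ultimately show ?thesis by simp
      qed
      then have "\<phi> = \<phi>0" using \<phi> by (auto simp: \<phi>0_def \<Phi>_def PiE_def extensional_def)
      with \<phi> show False by blast
    qed
  qed
  also have "\<dots> = - c \<phi>0"
  proof -
    have m: "?m > 0" using xs by (auto simp: zero_sum_mod_def)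
    \<comment> \<open>Following the walk moves each vertex to the next; the last one is divisible by
      n and returns to \<open>p 0\<close>, which is 0.\<close>
    have "(\<Sum>k<?m. q ^ (\<phi>0 k + p k)) = (\<Sum>k<?m. q ^ p (Suc k))"
      by (intro sum.cong refl) (simp add: \<phi>0_def p_def take_Suc_conv_app_nth add.commute)
    moreover have "(\<Sum>k<?m. q ^ p (Suc k)) + q ^ p 0 = B + q ^ p ?m"
      using sum.lessThan_Suc_shift[of "\<lambda>k. q ^ p k" ?m] by (simp add: B_def)
    moreover have "[q ^ p ?m = q ^ p 0] (mod (q ^ n - 1))"
      using power_cong_mod_exponent[of q "p ?m" n] q_ge_2 partial_sum_length[OF xs shortest]
      by (simp add: p_def)
    ultimately have "[(\<Sum>k<?m. q ^ (\<phi>0 k + p k)) + q ^ p 0 = B + q ^ p 0] (mod (q ^ n - 1))"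
      by (simp add: cong_add_lcancel_nat)
    then show ?thesis by (simp add: t_def cong_add_rcancel_nat)
  qed
  finally have "(\<Sum>x\<in>-{0}. (f x / x) ^ B) = - c \<phi>0" .
  moreover have "c \<phi>0 \<noteq> 0"
  proof -
    have "a (xs ! k) \<noteq> 0" if "k < ?m" for k
      using xsS[OF that] by (simp add: S)
    then show ?thesis by (simp add: c_def \<phi>0_def frobenius_eq_0_iff)
  qed
  ultimately show ?thesis by (simp add: B_def)
qed

text \<open>If a shortest closed walk on the support of f had fewer than n steps, its power sum
  would be nonzero for f, hence also for x^(q^j), whose only summand shifts the vertices by j. The
  vertex set would then be invariant under this shift and so all of Z/n, a contradiction. Hence f
  has one term.\<close>

lemma direction_set_determines_monomial:
  fixes f :: "'a \<Rightarrow> 'a"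
  assumes j: "coprime j n" and add: "additive f"
    and lin: "\<And>c x. c ^ q = c \<Longrightarrow> f (c * x) = c * f x"
    and dir: "\<And>b. (\<exists>x. x \<noteq> 0 \<and> f x = b * x) \<longleftrightarrow> (\<exists>x. x \<noteq> 0 \<and> x ^ (q ^ j) = b * x)"
  obtains k e where "coprime k n" "e \<noteq> 0" "\<And>x. f x = e * (x / e) ^ (q ^ k)"
proof -
  define a where "a i = conj_coeff 1 i f" for i
  have f: "f x = (\<Sum>i<n. a i * x ^ (q ^ i))" for x
    using base_linear_expansion[OF _ add lin, of 1] by (simp add: a_def)
  define S where "S = {i. i < n \<and> a i \<noteq> 0}"
  \<comment> \<open>The map x^(q^j) fixes 1, so the slope 1 occurs. The resulting vector y fixed by
    f becomes the scalar \<open>e\<close>.\<close>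
  have "\<exists>y. y \<noteq> 0 \<and> f y = 1 * y" by (subst dir) (auto intro!: exI[of _ 1])
  then obtain y where y: "y \<noteq> 0" "f y = y" by auto
  have "S \<noteq> {}"
  proof
    assume "S = {}"
    then have "f y = 0" unfolding f S_def by (intro sum.neutral) auto
    with y show False by simp
  qed
  then obtain s0 where "s0 \<in> S" by blast
  \<comment> \<open>n copies of one step close up, so a shortest closed walk exists.\<close>
  then have "zero_sum_mod n S (replicate n s0)"
    using n_pos by (simp add: zero_sum_mod_def sum_list_replicate)
  then obtain xs where xs: "zero_sum_mod n S xs"
    and shortest: "\<And>ys. zero_sum_mod n S ys \<Longrightarrow> length xs \<le> length ys"
    using ex_has_least_nat[of "zero_sum_mod n S" _ length] by blast
  define p where "p k = sum_list (take k xs)" for k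
  let ?m = "length xs"
  have "n \<le> ?m"
  proof (rule ccontr)
    assume "\<not> n \<le> ?m"
    then have m: "?m < n" by simp
    define B where "B = (\<Sum>k<?m. q ^ p k)"
    have "(\<Sum>x\<in>-{0}. (x ^ (q ^ j) / x) ^ B) = (\<Sum>x\<in>-{0}. (f x / x) ^ B)"
      by (rule direction_power_sums[OF frobenius_additive add dir[symmetric]])
    also have "\<dots> \<noteq> 0"
      unfolding B_def p_def by (rule power_sum_nonzero_of_shortest_zero_sum[OF f S_def xs shortest m])
    also have "(\<Sum>x\<in>-{0::'a}. (x ^ (q ^ j) / x) ^ B) = (\<Sum>x\<in>-{0}. x ^ (\<Sum>k<?m. q ^ (j + p k)) / x ^ B)"
      by (simp add: power_divide B_def sum_distrib_left power_add flip: power_mult)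
    finally have "[(\<Sum>k<?m. q ^ (j + p k)) = B] (mod (q ^ n - 1))"
      unfolding sum_power_quotient by argo
    then have im: "(\<lambda>k. (j + p k) mod n) ` {..<?m} = (\<lambda>k. p k mod n) ` {..<?m}"
      using power_sums_cong_imp_bij[OF q_ge_2 n_pos, of "{..<?m}" "{..<?m}" p "\<lambda>k. j + p k"]
        partial_sums_distinct[OF xs shortest] m by (auto simp: p_def B_def)
    have "card ((\<lambda>k. p k mod n) ` {..<?m}) = n"
    proof (rule coprime_shift_invariant_card[OF j n_pos])
      show "0 \<in> (\<lambda>k. p k mod n) ` {..<?m}"
        using xs by (intro image_eqI[of _ _ 0]) (auto simp: p_def zero_sum_mod_def)
      fix i assume "i \<in> (\<lambda>k. p k mod n) ` {..<?m}"
      then obtain k where "k < ?m" "i = p k mod n" by auto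
      then have "(j + i) mod n = (j + p k) mod n" by (simp add: mod_add_right_eq)
      also have "\<dots> \<in> (\<lambda>k. p k mod n) ` {..<?m}" using im \<open>k < ?m\<close> by blast
      finally show "(j + i) mod n \<in> (\<lambda>k. p k mod n) ` {..<?m}" .
    qed (use n_pos in auto)
    then show False using card_image_le[of "{..<?m}" "\<lambda>k. p k mod n"] m by simp
  qed
  with shortest have "\<And>ys. zero_sum_mod n S ys \<Longrightarrow> n \<le> length ys" by (meson order_trans)
  then obtain s where s: "S = {s}" "coprime s n" "s < n"
    using long_zero_sums_imp_singleton[OF n_ge_2, of S] \<open>S \<noteq> {}\<close> by (auto simp: S_def)
  have fs: "f x = a s * x ^ (q ^ s)" for x
  proof -
    have "f x = (\<Sum>i\<in>{s}. a i * x ^ (q ^ i))"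
      unfolding f by (rule sum.mono_neutral_right) (use s in \<open>auto simp: S_def\<close>)
    then show ?thesis by simp
  qed
  have "f x = y * (x / y) ^ (q ^ s)" for x
    using y fs[of x] fs[of y] by (simp add: power_divide field_simps)
  with that s y show ?thesis by blast
qed

end

section \<open>Pencils of linear maps with equal directions\<close>

text \<open>Dividing by \<alpha>^A and summing extracts a coefficient in the pencil parameter
  \<alpha>. The substitution a = x \<alpha> makes the innermost sum depend on x only through
  \<open>G x\<close>.\<close>

lemma sum_directions_reindex:
  fixes G :: "'a::{finite,field} \<Rightarrow> 'a"
  shows "(\<Sum>\<alpha>\<in>-{0}. (\<Sum>x\<in>-{0}. (((x * \<alpha>) ^ e + G x) / x) ^ B) / \<alpha> ^ A) =
    (\<Sum>x\<in>-{0}. (\<Sum>a\<in>-{0}. (a ^ e + G x) ^ B / a ^ A) * (x ^ A / x ^ B))"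
proof -
  have "(\<Sum>\<alpha>\<in>-{0}. (\<Sum>x\<in>-{0}. (((x * \<alpha>) ^ e + G x) / x) ^ B) / \<alpha> ^ A) =
    (\<Sum>x\<in>-{0}. \<Sum>\<alpha>\<in>-{0}. (((x * \<alpha>) ^ e + G x) / x) ^ B / \<alpha> ^ A)"
    unfolding sum_divide_distrib by (rule sum.swap)
  also have "\<dots> = (\<Sum>x\<in>-{0}. \<Sum>a\<in>-{0}. (a ^ e + G x) ^ B / a ^ A * (x ^ A / x ^ B))"
  proof (rule sum.cong[OF refl])
    fix x :: 'a assume "x \<in> -{0}"
    then show "(\<Sum>\<alpha>\<in>-{0}. (((x * \<alpha>) ^ e + G x) / x) ^ B / \<alpha> ^ A) =
      (\<Sum>a\<in>-{0}. (a ^ e + G x) ^ B / a ^ A * (x ^ A / x ^ B))"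
      by (intro sum.reindex_bij_witness[of _ "\<lambda>a. a / x" "\<lambda>\<alpha>. x * \<alpha>"])
        (auto simp: power_divide power_mult_distrib)
  qed
  finally show ?thesis by (simp only: sum_distrib_right)
qed

lemma inj_on_add_mod:
  fixes n t :: nat
  assumes "S \<subseteq> {..<n}"
  shows "inj_on (\<lambda>i. (i + t) mod n) S"
proof (rule inj_onI)
  fix a b assume ab: "a \<in> S" "b \<in> S" "(a + t) mod n = (b + t) mod n"
  then have "[a = b] (mod n)" using cong_add_rcancel_nat[of a t b n] by (simp add: cong_def)
  moreover have "a < n" "b < n" using ab assms by auto
  ultimately show "a = b" using cong_less_modulus_unique_nat by blast
qed

text \<open>The element s that reaches 1 is 0, with t = 1, or else n + 1 - t, which is at least 2.
  In the second case s - 1 and s - 2 would reach 0 and n - 1, outside the range 1 to m, so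
  \<open>S\<close> misses two of the m + 1 indices and is too small.\<close>

lemma shifted_arc:
  fixes n t m :: nat
  assumes "S \<subseteq> {..m}" "Suc m < n" "0 < t" "t < n" "m \<ge> 1"
    and im: "inj_on (\<lambda>i. (i + t) mod n) S" "(\<lambda>i. (i + t) mod n) ` S = Suc ` {..<m}"
  shows "t = 1"
proof (rule ccontr)
  assume "t \<noteq> 1"
  have "1 \<in> (\<lambda>i. (i + t) mod n) ` S" using im(2) assms(5) by auto
  then obtain s where s: "s \<in> S" "(s + t) mod n = 1" by auto
  have s': "s \<le> m" using s assms(1) by auto
  have st: "s + t = n + 1"
  proof -
    have "s + t < n + n" using s' assms by simp
    then have "s + t = 1 \<or> s + t = n + 1"
      using s(2) by (cases "s + t < n") (auto simp: mod_if[of "s + t" n])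
    then show ?thesis using \<open>t \<noteq> 1\<close> assms by auto
  qed
  have s2: "s \<ge> 2" using st assms by simp
  have "s - 1 \<notin> S"
  proof
    assume "s - 1 \<in> S"
    moreover have "(s - 1 + t) mod n = 0" using st s2 by simp
    ultimately have "0 \<in> Suc ` {..<m}" unfolding im(2)[symmetric] by force
    then show False by simp
  qed
  moreover have "s - 2 \<notin> S"
  proof
    assume "s - 2 \<in> S"
    moreover have "(s - 2 + t) mod n = n - 1"
    proof -
      have "s - 2 + t = n - 1" using st s2 by simp
      then show ?thesis using assms by simp
    qed
    ultimately have "n - 1 \<in> Suc ` {..<m}" unfolding im(2)[symmetric] by force
    then show False using assms by auto
  qed
  ultimately have "S \<subseteq> {..m} - {s - 1, s - 2}" using assms(1) by auto
  then have "card S \<le> card ({..m} - {s - 1, s - 2})" by (intro card_mono) auto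
  also have "\<dots> = Suc m - 2" using s' s2 by (subst card_Diff_subset) auto
  finally have "card S < m" using assms by simp
  moreover have "card S = m" using card_image[OF im(1)] im(2) by (simp add: card_image)
  ultimately show False by simp
qed

section \<open>Coefficient extraction in pencils\<close>

locale conjugation = finite_field_extension q n F
  for q n :: nat and F :: "'a::{finite,field} itself" +
  fixes j :: nat
  assumes coprime_j: "coprime j n"
begin

definition \<sigma> :: nat where "\<sigma> = q ^ j"

lemma \<sigma>_power: "\<sigma> ^ i = q ^ (j * i)" by (simp add: \<sigma>_def power_mult)

lemma \<sigma>_power_pos [simp]: "\<sigma> ^ i > 0" by (simp add: \<sigma>_power del: q_power_pos) (use q_ge_2 in simp)

lemma \<sigma>_add: "(x + y :: 'a) ^ (\<sigma> ^ i) = x ^ (\<sigma> ^ i) + y ^ (\<sigma> ^ i)"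
  unfolding \<sigma>_power by (rule frobenius_add)

lemma \<sigma>_additive: "additive (\<lambda>x::'a. x ^ (\<sigma> ^ i))" by standard (rule \<sigma>_add)

lemma \<sigma>_sum: "(\<Sum>i\<in>A. g i :: 'a) ^ (\<sigma> ^ k) = (\<Sum>i\<in>A. g i ^ (\<sigma> ^ k))"
  using additive.sum[OF \<sigma>_additive] .

lemma \<sigma>_eq_0_iff: "(x::'a) ^ (\<sigma> ^ k) = 0 \<longleftrightarrow> x = 0"
  using \<sigma>_power_pos[of k] by simp

lemma \<sigma>_n: "(x::'a) ^ (\<sigma> ^ n) = x"
  using frobenius_mod[of x "j * n"] by (simp add: \<sigma>_power)

lemma \<sigma>_sums_cong:
  assumes "finite M" "finite N" "inj_on (\<lambda>s. \<psi> s mod n) N" "card N < n"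
    and "[(\<Sum>s\<in>M. \<sigma> ^ \<phi> s) = (\<Sum>s\<in>N. \<sigma> ^ \<psi> s)] (mod (q ^ n - 1))"
    and "card M \<le> card N \<or> (inj_on (\<lambda>s. \<phi> s mod n) M \<and> card M < n)"
  shows "inj_on (\<lambda>s. \<phi> s mod n) M" "(\<lambda>s. \<phi> s mod n) ` M = (\<lambda>s. \<psi> s mod n) ` N"
  using conjugate_sums_cong_imp_bij[OF q_ge_2 n_pos coprime_j assms(1-4), of \<phi>] assms(5,6)
  by (simp_all add: \<sigma>_def)

text \<open>The power is a product of binomials a^(\<sigma>^(i+t)) + y^(\<sigma>^i).
  \<open>S\<close> records the factors that contribute a, and orthogonality in a keeps the exponents
  congruent to \<open>A\<close>.\<close>

lemma power_sum_extract:
  "(\<Sum>a\<in>-{0::'a}. (a ^ (\<sigma> ^ t) + y) ^ (\<Sum>i\<le>m. \<sigma> ^ i) / a ^ A) =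
   - (\<Sum>S | S \<subseteq> {..m} \<and> [(\<Sum>i\<in>S. \<sigma> ^ (i + t)) = A] (mod (q ^ n - 1)). \<Prod>i\<in>{..m} - S. y ^ (\<sigma> ^ i))"
proof -
  let ?Y = "\<lambda>S. \<Prod>i\<in>{..m} - S. y ^ (\<sigma> ^ i)" and ?C = "\<lambda>S. [(\<Sum>i\<in>S. \<sigma> ^ (i + t)) = A] (mod (q ^ n - 1))"
  have "(a ^ (\<sigma> ^ t) + y) ^ (\<Sum>i\<le>m. \<sigma> ^ i) / a ^ A = (\<Sum>S\<in>Pow {..m}. ?Y S * (a ^ (\<Sum>i\<in>S. \<sigma> ^ (i + t)) / a ^ A))" for a :: 'a
  proof -
    have "(a ^ (\<sigma> ^ t) + y) ^ (\<Sum>i\<le>m. \<sigma> ^ i) = (\<Prod>i\<le>m. a ^ (\<sigma> ^ (i + t)) + y ^ (\<sigma> ^ i))"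
      by (simp add: power_sum \<sigma>_add power_add mult.commute flip: power_mult)
    also have "\<dots> = (\<Sum>S\<in>Pow {..m}. a ^ (\<Sum>i\<in>S. \<sigma> ^ (i + t)) * ?Y S)"
      by (subst prod_add) (simp_all add: power_sum)
    finally show ?thesis by (simp add: sum_divide_distrib mult.commute)
  qed
  then have "(\<Sum>a\<in>-{0::'a}. (a ^ (\<sigma> ^ t) + y) ^ (\<Sum>i\<le>m. \<sigma> ^ i) / a ^ A) =
    (\<Sum>S\<in>Pow {..m}. ?Y S * (\<Sum>a\<in>-{0::'a}. a ^ (\<Sum>i\<in>S. \<sigma> ^ (i + t)) / a ^ A))"
    by (simp only: sum.swap[of _ "Pow {..m}"] sum_distrib_left)
  also have "\<dots> = (\<Sum>S\<in>Pow {..m}. if ?C S then - ?Y S else 0)"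
    unfolding sum_power_quotient by (intro sum.cong refl) simp
  also have "\<dots> = (\<Sum>S\<in>{S \<in> Pow {..m}. ?C S}. - ?Y S)"
    by (rule sum.inter_filter[symmetric]) simp
  finally show ?thesis by (simp add: sum_negf)
qed

lemma same_arc:
  assumes "Suc m < n" "S \<subseteq> {..m}"
    and cong: "[(\<Sum>i\<in>S. \<sigma> ^ (i + 1)) = (\<Sum>i\<in>{b..<m}. \<sigma> ^ (i + 1))] (mod (q ^ n - 1))"
  shows "S = {b..<m}"
proof -
  have small: "(i + 1) mod n = i + 1" if "i \<le> m" for i using that assms(1) by simp
  have fin: "finite S" using assms(2) finite_subset by blast
  have "card S \<le> Suc m" using card_mono[OF _ assms(2)] by simp
  then have "(\<lambda>i. (i + 1) mod n) ` S = (\<lambda>i. (i + 1) mod n) ` {b..<m}"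
    using assms(1,2) by (intro \<sigma>_sums_cong(2)[OF fin _ _ _ cong])
      (auto intro!: inj_on_add_mod simp del: add_Suc_right One_nat_def)
  moreover have "(\<lambda>i. (i + 1) mod n) ` S = Suc ` S"
    by (rule image_cong[OF refl]) (use small assms(2) in auto)
  moreover have "(\<lambda>i. (i + 1) mod n) ` {b..<m} = Suc ` {b..<m}"
    by (rule image_cong[OF refl]) (use small in auto)
  ultimately have "Suc ` S = Suc ` {b..<m}" by simp
  then show ?thesis using inj_image_eq_iff[OF inj_Suc] by blast
qed

text \<open>Only one subset survives. The choice b = 0 leaves y^(\<sigma>^m), and b = 1 leaves y
  times y^(\<sigma>^m) when m >= 1; these yield the linear and the quadratic invariants
  below.\<close>

lemma extract_same:
  assumes "Suc m < n"
  shows "(\<Sum>a\<in>-{0::'a}. (a ^ (\<sigma> ^ 1) + y) ^ (\<Sum>i\<le>m. \<sigma> ^ i) / a ^ (\<Sum>i\<in>{b..<m}. \<sigma> ^ (i + 1))) =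
    - (\<Prod>i\<in>{..m} - {b..<m}. y ^ (\<sigma> ^ i))"
proof -
  have "{S. S \<subseteq> {..m} \<and> [(\<Sum>i\<in>S. \<sigma> ^ (i + 1)) = (\<Sum>i\<in>{b..<m}. \<sigma> ^ (i + 1))] (mod (q ^ n - 1))} = {{b..<m}}"
    using same_arc[OF assms] by auto
  then show ?thesis unfolding power_sum_extract by (simp only:) simp
qed

lemma extract_different:
  assumes "Suc m < n" "m \<ge> 1" "0 < t" "t < n" "t \<noteq> 1"
  shows "(\<Sum>a\<in>-{0::'a}. (a ^ (\<sigma> ^ t) + y) ^ (\<Sum>i\<le>m. \<sigma> ^ i) / a ^ (\<Sum>i\<in>{0..<m}. \<sigma> ^ (i + 1))) = 0"
proof -
  have False if S: "S \<subseteq> {..m}" and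
    cong: "[(\<Sum>i\<in>S. \<sigma> ^ (i + t)) = (\<Sum>i\<in>{0..<m}. \<sigma> ^ (i + 1))] (mod (q ^ n - 1))" for S
  proof -
    have small: "(i + 1) mod n = i + 1" if "i \<le> m" for i using that assms(1) by simp
    have fin: "finite S" using S finite_subset by blast
    have card: "card S \<le> Suc m" using card_mono[OF _ S] by simp
    have inj: "inj_on (\<lambda>i. (i + t) mod n) S"
      by (rule inj_on_add_mod) (use S assms(1) in auto)
    have "(\<lambda>i. (i + t) mod n) ` S = (\<lambda>i. (i + 1) mod n) ` {0..<m}"
      using assms(1) card inj by (intro \<sigma>_sums_cong(2)[OF fin _ _ _ cong])
        (auto intro!: inj_on_add_mod simp del: add_Suc_right One_nat_def)
    also have "\<dots> = Suc ` {0..<m}" by (rule image_cong[OF refl]) (use small in auto)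
    finally have "(\<lambda>i. (i + t) mod n) ` S = Suc ` {..<m}" by (simp add: lessThan_atLeast0)
    from shifted_arc[OF S assms(1,3,4,2) inj this] assms(5) show False by simp
  qed
  then have "{S. S \<subseteq> {..m} \<and> [(\<Sum>i\<in>S. \<sigma> ^ (i + t)) = (\<Sum>i\<in>{0..<m}. \<sigma> ^ (i + 1))] (mod (q ^ n - 1))} = {}"
    by blast
  then show ?thesis unfolding power_sum_extract by (simp only: sum.empty minus_zero)
qed

text \<open>Up to sign and conjugation this is the coefficient of index n - m, in the form in which
  the extraction produces it. The indices 2 to n - 1 correspond to 1 <= m <= n - 2.\<close>

definition \<gamma> :: "nat \<Rightarrow> ('a \<Rightarrow> 'a) \<Rightarrow> 'a" where
  "\<gamma> m f = (\<Sum>x\<in>-{0}. f x ^ (\<sigma> ^ m) / x)"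

lemma \<gamma>_conj_coeff: "m \<le> n \<Longrightarrow> \<gamma> m f = (- conj_coeff j (n - m) f) ^ (\<sigma> ^ m)"
proof -
  assume m: "m \<le> n"
  have "(x ^ (\<sigma> ^ (n - m))) ^ (\<sigma> ^ m) = x" for x :: 'a
    using m \<sigma>_n[of x] by (simp flip: power_mult power_add)
  then show ?thesis
    by (simp add: \<gamma>_def conj_coeff_def \<sigma>_sum power_divide flip: \<sigma>_def)
qed

lemma \<gamma>_0: "\<gamma> 0 f = - conj_coeff j 0 f"
  by (simp add: \<gamma>_def conj_coeff_def)

lemma \<gamma>_diff: "\<gamma> m (\<lambda>x. f x - g x) = \<gamma> m f - \<gamma> m g"
  by (simp add: \<gamma>_def additive.diff[OF \<sigma>_additive] diff_divide_distrib sum_subtractf)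

lemma \<gamma>_add: "\<gamma> m (\<lambda>x. f x + g x) = \<gamma> m f + \<gamma> m g"
  by (simp add: \<gamma>_def \<sigma>_add add_divide_distrib sum.distrib)

lemma two_term_expansion:
  assumes "additive f" "\<And>c x. c ^ q = c \<Longrightarrow> f (c * x) = c * f x"
    and "\<And>m. 1 \<le> m \<Longrightarrow> Suc m < n \<Longrightarrow> \<gamma> m f = 0"
  shows "f x = conj_coeff j 0 f * x + conj_coeff j 1 f * x ^ \<sigma>"
proof -
  have "conj_coeff j i f = 0" if "2 \<le> i" "i < n" for i
  proof -
    have "\<gamma> (n - i) f = 0" using that by (intro assms(3)) auto
    then show ?thesis using that \<gamma>_conj_coeff[of "n - i" f] by (simp add: \<sigma>_eq_0_iff)
  qed
  then have "(\<Sum>i<n. conj_coeff j i f * x ^ (\<sigma> ^ i)) = (\<Sum>i\<in>{0, 1}. conj_coeff j i f * x ^ (\<sigma> ^ i))"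
    using n_ge_2 by (intro sum.mono_neutral_right) auto
  moreover have "f x = (\<Sum>i<n. conj_coeff j i f * x ^ (\<sigma> ^ i))"
    unfolding \<sigma>_def by (rule base_linear_expansion[OF coprime_j assms(1,2)])
  ultimately have "f x = (\<Sum>i\<in>{0, 1}. conj_coeff j i f * x ^ (\<sigma> ^ i))" by simp
  then show ?thesis by simp
qed

text \<open>\<open>G\<close> and \<open>H\<close> stand for the restrictions c -> G (c v) and c -> H
  (c v) to one vector v. Condition \<open>dir\<close> is the equality of the two point sets at the
  vector with coordinates a and b that differs from v by an element of T.\<close>

context
  fixes G H :: "'a \<Rightarrow> 'a" and t :: nat
  assumes addG: "additive G" and addH: "additive H"
    and dir: "\<And>a b. (\<exists>c. c \<noteq> 0 \<and> c * b = (c * a) ^ (\<sigma> ^ 1) + G c) \<longleftrightarrow>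
                     (\<exists>c. c \<noteq> 0 \<and> c * b = (c * a) ^ (\<sigma> ^ t) + H c)"
begin

text \<open>For each value of the parameter the two maps have the same directions, so their power
  sums agree, and with them every coefficient in the parameter.\<close>

lemma double_sums_eq:
  "(\<Sum>x\<in>-{0}. (\<Sum>a\<in>-{0}. (a ^ (\<sigma> ^ 1) + G x) ^ B / a ^ A) * (x ^ A / x ^ B)) =
   (\<Sum>x\<in>-{0}. (\<Sum>a\<in>-{0}. (a ^ (\<sigma> ^ t) + H x) ^ B / a ^ A) * (x ^ A / x ^ B))"
proof -
  have add: "additive (\<lambda>x. (x * \<alpha>) ^ (\<sigma> ^ u) + g x)" if "additive g" for g :: "'a \<Rightarrow> 'a" and \<alpha> u
    by standard (simp add: distrib_right \<sigma>_add additive.add[OF that])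
  have "(\<Sum>x\<in>-{0}. (((x * \<alpha>) ^ (\<sigma> ^ 1) + G x) / x) ^ B) = (\<Sum>x\<in>-{0}. (((x * \<alpha>) ^ (\<sigma> ^ t) + H x) / x) ^ B)" for \<alpha>
    by (rule direction_power_sums[OF add[OF addG] add[OF addH]])
      (use dir[of _ \<alpha>] in \<open>simp add: mult.commute eq_commute\<close>)
  then show ?thesis unfolding sum_directions_reindex[symmetric] by simp
qed

lemma power_quotient: "(x::'a) \<noteq> 0 \<Longrightarrow> x ^ (\<Sum>i\<in>{0..<m}. \<sigma> ^ (i + 1)) / x ^ (\<Sum>i\<le>m. \<sigma> ^ i) = 1 / x"
proof -
  have "(\<Sum>i\<le>m. \<sigma> ^ i) = 1 + (\<Sum>i\<in>{0..<m}. \<sigma> ^ (i + 1))"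
    by (simp add: sum.atMost_shift atLeast0LessThan)
  then show "x \<noteq> 0 \<Longrightarrow> ?thesis" by (simp add: power_add)
qed

lemma \<gamma>_extract:
  assumes "Suc m < n"
  shows "\<gamma> m f = - (\<Sum>x\<in>-{0}. (\<Sum>a\<in>-{0}. (a ^ (\<sigma> ^ 1) + f x) ^ (\<Sum>i\<le>m. \<sigma> ^ i) / a ^ (\<Sum>i\<in>{0..<m}. \<sigma> ^ (i + 1)))
    * (x ^ (\<Sum>i\<in>{0..<m}. \<sigma> ^ (i + 1)) / x ^ (\<Sum>i\<le>m. \<sigma> ^ i)))"
proof -
  have set: "{..m} - {0..<m} = {m}" by auto
  show ?thesis unfolding extract_same[OF assms] \<gamma>_def sum_negf[symmetric] set
  proof (rule sum.cong[OF refl])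
    fix x :: 'a assume "x \<in> -{0}"
    then have "x \<noteq> 0" by simp
    from power_quotient[OF this] show "f x ^ (\<sigma> ^ m) / x = - (- (\<Prod>i\<in>{m}. f x ^ (\<sigma> ^ i))
      * (x ^ (\<Sum>i\<in>{0..<m}. \<sigma> ^ (i + 1)) / x ^ (\<Sum>i\<le>m. \<sigma> ^ i)))" by (simp only:) simp
  qed
qed

text \<open>On the side of \<open>H\<close> the different twist leaves no subset in the extraction,
  so the coefficient extracted from \<open>G\<close> is zero.\<close>

lemma \<gamma>_vanishes:
  assumes "Suc m < n" "m \<ge> 1" "0 < t" "t < n" "t \<noteq> 1"
  shows "\<gamma> m G = 0"
  unfolding \<gamma>_extract[OF assms(1)] double_sums_eq extract_different[OF assms] by simp

lemma \<gamma>_eq: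
  assumes "t = 1" "Suc m < n"
  shows "\<gamma> m G = \<gamma> m H"
  using double_sums_eq unfolding \<gamma>_extract[OF assms(2)] assms(1) by simp

text \<open>The values \<gamma> m with m + 1 < n miss the coefficient of index 1. This second
  extraction, with the summand \<sigma> dropped from the exponent of a, serves to determine
  it.\<close>

lemma quadratic_sum_eq:
  assumes t: "t = 1" and m: "Suc m < n" "m \<ge> 1"
  shows "(\<Sum>x\<in>-{0}. G x * G x ^ (\<sigma> ^ m) / (x * x ^ \<sigma>)) = (\<Sum>x\<in>-{0}. H x * H x ^ (\<sigma> ^ m) / (x * x ^ \<sigma>))"
proof -
  let ?A = "\<Sum>i\<in>{1..<m}. \<sigma> ^ (i + 1)" and ?B = "\<Sum>i\<le>m. \<sigma> ^ i"
  have B: "?B = 1 + \<sigma> + ?A"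
  proof -
    have "?B = 1 + (\<Sum>i\<in>{0..<m}. \<sigma> ^ (i + 1))" by (simp add: sum.atMost_shift atLeast0LessThan)
    also have "(\<Sum>i\<in>{0..<m}. \<sigma> ^ (i + 1)) = \<sigma> + ?A"
      using m(2) by (subst sum.atLeast_Suc_lessThan) auto
    finally show ?thesis by simp
  qed
  have quot: "x ^ ?A / x ^ ?B = 1 / (x * x ^ \<sigma>)" if "x \<noteq> 0" for x :: 'a
    unfolding B using that by (simp add: power_add)
  have set: "{..m} - {1..<m} = {0, m}" using m by auto
  have "(\<Sum>x\<in>-{0}. f x * f x ^ (\<sigma> ^ m) / (x * x ^ \<sigma>)) =
    - (\<Sum>x\<in>-{0}. (\<Sum>a\<in>-{0}. (a ^ (\<sigma> ^ 1) + f x) ^ ?B / a ^ ?A) * (x ^ ?A / x ^ ?B))" for f :: "'a \<Rightarrow> 'a"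
    unfolding extract_same[OF m(1)] set sum_negf[symmetric]
  proof (rule sum.cong[OF refl])
    fix x :: 'a assume "x \<in> -{0}"
    then have "x \<noteq> 0" by simp
    from quot[OF this] show "f x * f x ^ (\<sigma> ^ m) / (x * x ^ \<sigma>) =
      - (- (\<Prod>i\<in>{0, m}. f x ^ (\<sigma> ^ i)) * (x ^ ?A / x ^ ?B))" using m(2) by (simp only:) simp
  qed
  then show ?thesis using double_sums_eq unfolding t by simp
qed

text \<open>By \<open>\<gamma>_eq\<close> the coefficients of \<open>G\<close> and \<open>H\<close>
  agree except possibly at index 1, so G x = H x + d x^\<sigma>. Substituted into the quadratic
  sums, this leaves d times \<open>\<gamma> m H\<close>, which must vanish.\<close>

lemma cone_type_or_equal:
  assumes t: "t = 1"
    and linG: "\<And>c x. c ^ q = c \<Longrightarrow> G (c * x) = c * G x"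
    and linH: "\<And>c x. c ^ q = c \<Longrightarrow> H (c * x) = c * H x"
    and m: "Suc m < n" "m \<ge> 1" and ne: "\<gamma> m G \<noteq> 0"
  shows "G x = H x"
proof -
  define D where "D x = G x - H x" for x
  define d where "d = conj_coeff j 1 D"
  have addD: "additive D" by standard (simp add: D_def additive.add[OF addG] additive.add[OF addH])
  have linD: "D (c * x) = c * D x" if "c ^ q = c" for c x
    using that by (simp add: D_def linG linH right_diff_distrib)
  have \<gamma>D: "\<gamma> k D = 0" if "Suc k < n" for k
    using \<gamma>_eq[OF t that] \<gamma>_diff[of k G H] by (simp add: D_def[abs_def])
  have "D x = d * x ^ \<sigma>" for x
    using two_term_expansion[OF addD linD, of x] \<gamma>D \<gamma>D[of 0] n_ge_2 m
    by (simp add: d_def \<gamma>_0)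
  then have G: "G x = H x + d * x ^ \<sigma>" for x by (simp add: D_def algebra_simps)
  \<comment> \<open>No term survives: as 2 <= m + 1 < n, the exponents i and m + 1 are never 0 and 1
    modulo n in some order.\<close>
  have three: "(\<Sum>x\<in>-{0}. H x * x ^ (\<sigma> ^ Suc m) / (x * x ^ \<sigma>)) = 0"
  proof -
    have "(\<Sum>x\<in>-{0}. H x * x ^ (\<sigma> ^ Suc m) / (x * x ^ \<sigma>)) =
      (\<Sum>x\<in>-{0}. \<Sum>i<n. conj_coeff j i H * (x ^ (\<sigma> ^ i + \<sigma> ^ Suc m) / x ^ (1 + \<sigma>)))"
    proof (rule sum.cong[OF refl])
      fix x :: 'a
      have "H x * x ^ (\<sigma> ^ Suc m) / (x * x ^ \<sigma>) =
        (\<Sum>i<n. conj_coeff j i H * x ^ (\<sigma> ^ i)) * (x ^ (\<sigma> ^ Suc m) / x ^ (1 + \<sigma>))"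
        using base_linear_expansion[OF coprime_j addH linH, of x] by (simp add: power_add flip: \<sigma>_def)
      also have "\<dots> = (\<Sum>i<n. conj_coeff j i H * (x ^ (\<sigma> ^ i + \<sigma> ^ Suc m) / x ^ (1 + \<sigma>)))"
        unfolding sum_distrib_right by (intro sum.cong refl) (simp add: power_add)
      finally show "H x * x ^ (\<sigma> ^ Suc m) / (x * x ^ \<sigma>) =
        (\<Sum>i<n. conj_coeff j i H * (x ^ (\<sigma> ^ i + \<sigma> ^ Suc m) / x ^ (1 + \<sigma>)))" .
    qed
    also have "\<dots> = (\<Sum>i<n. conj_coeff j i H * (\<Sum>x\<in>-{0::'a}. x ^ (\<sigma> ^ i + \<sigma> ^ Suc m) / x ^ (1 + \<sigma>)))"
      by (subst sum.swap) (simp add: sum_distrib_left)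
    also have "\<dots> = 0"
    proof (rule sum.neutral, intro ballI)
      fix i assume "i \<in> {..<n}"
      have "\<not> [\<sigma> ^ i + \<sigma> ^ Suc m = 1 + \<sigma>] (mod (q ^ n - 1))"
      proof
        assume "[\<sigma> ^ i + \<sigma> ^ Suc m = 1 + \<sigma>] (mod (q ^ n - 1))"
        \<comment> \<open>Booleans index the two summands, as the comparison of conjugate sums needs
          an index set.\<close>
        then have "[(\<Sum>b\<in>{True, False}. \<sigma> ^ (if b then i else Suc m)) = (\<Sum>b\<in>{True, False}. \<sigma> ^ (if b then 0 else 1))] (mod (q ^ n - 1))"
          by simp
        then have "(\<lambda>b. (if b then i else Suc m) mod n) ` {True, False} = (\<lambda>b. (if b then 0 else 1) mod n) ` {True, False}"
          using m n_ge_2 by (intro \<sigma>_sums_cong(2)) (auto simp: inj_on_def)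
        then have eq: "{i mod n, Suc m mod n} = {0, 1 mod n}"
          by (simp only: image_insert image_empty if_True if_False mod_0)
        have "Suc m mod n \<in> {0, 1 mod n}" unfolding eq[symmetric] by simp
        then show False using m by simp
      qed
      then show "conj_coeff j i H * (\<Sum>x\<in>-{0::'a}. x ^ (\<sigma> ^ i + \<sigma> ^ Suc m) / x ^ (1 + \<sigma>)) = 0"
        unfolding sum_power_quotient by simp
    qed
    finally show ?thesis .
  qed
  have four: "(\<Sum>x\<in>-{0::'a}. x ^ (\<sigma> ^ Suc m) / x) = 0"
  proof -
    have "\<not> [\<sigma> ^ Suc m = 1] (mod (q ^ n - 1))"
      using conjugate_cong_iff[OF coprime_j, of "Suc m" 0] m by (simp add: \<sigma>_def)
    then show ?thesis using sum_power_quotient[of "\<sigma> ^ Suc m" 1] by simp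
  qed
  have "(\<Sum>x\<in>-{0}. G x * G x ^ (\<sigma> ^ m) / (x * x ^ \<sigma>)) =
    (\<Sum>x\<in>-{0}. H x * H x ^ (\<sigma> ^ m) / (x * x ^ \<sigma>) + d * (H x ^ (\<sigma> ^ m) / x)
      + d ^ (\<sigma> ^ m) * (H x * x ^ (\<sigma> ^ Suc m) / (x * x ^ \<sigma>)) + d * d ^ (\<sigma> ^ m) * (x ^ (\<sigma> ^ Suc m) / x))"
  proof (rule sum.cong[OF refl])
    fix x :: 'a assume "x \<in> -{0}"
    then have x: "x \<noteq> 0" "x ^ \<sigma> \<noteq> 0" by auto
    have pw: "(d * x ^ \<sigma>) ^ (\<sigma> ^ m) = d ^ (\<sigma> ^ m) * x ^ (\<sigma> ^ Suc m)"
      by (simp add: power_mult_distrib flip: power_mult)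
    define z w h k where "z = x ^ \<sigma>" and "w = x ^ (\<sigma> ^ Suc m)" and "h = H x" and "k = H x ^ (\<sigma> ^ m)"
    have z: "z \<noteq> 0" using x by (simp add: z_def)
    have "(h + d * z) * (k + d ^ (\<sigma> ^ m) * w) / (x * z) =
      h * k / (x * z) + d * (k / x) + d ^ (\<sigma> ^ m) * (h * w / (x * z)) + d * d ^ (\<sigma> ^ m) * (w / x)"
      using x(1) z by (simp add: divide_simps) (simp add: algebra_simps)
    then show "G x * G x ^ (\<sigma> ^ m) / (x * x ^ \<sigma>) = H x * H x ^ (\<sigma> ^ m) / (x * x ^ \<sigma>) + d * (H x ^ (\<sigma> ^ m) / x)
      + d ^ (\<sigma> ^ m) * (H x * x ^ (\<sigma> ^ Suc m) / (x * x ^ \<sigma>)) + d * d ^ (\<sigma> ^ m) * (x ^ (\<sigma> ^ Suc m) / x)"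
      unfolding G \<sigma>_add pw by (simp only: z_def w_def h_def k_def)
  qed
  also have "\<dots> = (\<Sum>x\<in>-{0}. H x * H x ^ (\<sigma> ^ m) / (x * x ^ \<sigma>)) + d * \<gamma> m H"
    by (simp only: sum.distrib three four \<gamma>_def flip: sum_distrib_left) simp
  finally have "d * \<gamma> m H = 0" using quadratic_sum_eq[OF t m] by simp
  then have "d = 0" using ne \<gamma>_eq[OF t m(1)] by simp
  with G show ?thesis by simp
qed

end

end

section \<open>Vector spaces of functions and their point sets\<close>

lemma vector_space_vsmult: "vector_space (vsmult :: 'a::field \<Rightarrow> ('r \<Rightarrow> 'a) \<Rightarrow> ('r \<Rightarrow> 'a))"
  by unfold_locales (auto simp: vsmult_def fun_eq_iff algebra_simps)

interpretation vs: vector_space "vsmult :: 'a::field \<Rightarrow> ('r \<Rightarrow> 'a) \<Rightarrow> ('r \<Rightarrow> 'a)"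
  by (rule vector_space_vsmult)

lemma K_indep_UNIV: "finite B \<Longrightarrow> K_indep UNIV B \<longleftrightarrow> vs.independent B"
  by (auto simp: K_indep_def vs.dependent_finite)

lemma K_span_UNIV: "finite B \<Longrightarrow> K_span UNIV B = vs.span B"
  by (auto simp: K_span_def vs.span_finite)

lemma K_subspace_UNIV: "K_subspace UNIV X \<longleftrightarrow> vs.subspace X"
  by (auto simp: K_subspace_def vs.subspace_def)

text \<open>Coordinates with respect to a basis give a bijection with the functions from the basis
  to \<open>K\<close>. This serves both the base field and the whole field.\<close>

lemma K_dim_imp_subspace_card:
  fixes K :: "'a::field set" and X :: "('r \<Rightarrow> 'a) set"
  assumes zero: "0 \<in> K" and diff: "\<And>x y. x \<in> K \<Longrightarrow> y \<in> K \<Longrightarrow> x - y \<in> K"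
    and mult: "\<And>x y. x \<in> K \<Longrightarrow> y \<in> K \<Longrightarrow> x * y \<in> K" and dim: "K_dim K X d"
  shows "K_subspace K X" "card X = card K ^ d"
proof -
  obtain B where B: "finite B" "card B = d" "K_indep K B" "K_span K B = X"
    using dim unfolding K_dim_def by blast
  let ?s = "\<lambda>c. \<Sum>v\<in>B. vsmult (c v) v"
  have plus: "x + y \<in> K" if "x \<in> K" "y \<in> K" for x y
    using diff[OF that(1) diff[OF zero that(2)]] by simp
  have in_X: "u \<in> X \<longleftrightarrow> (\<exists>c. u = ?s c \<and> (\<forall>v\<in>B. c v \<in> K))" for u
    using B(4) by (auto simp: K_span_def)
  show "K_subspace K X"
    unfolding K_subspace_def
  proof (intro conjI ballI)
    show "0 \<in> X" unfolding in_X by (rule exI[of _ "\<lambda>_. 0"]) (simp add: zero)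
  next
    fix u w assume "u \<in> X" "w \<in> X"
    then obtain c d where "u = ?s c" "w = ?s d" "\<forall>v\<in>B. c v \<in> K" "\<forall>v\<in>B. d v \<in> K" unfolding in_X by blast
    then show "u + w \<in> X" unfolding in_X
      by (intro exI[of _ "\<lambda>v. c v + d v"]) (simp add: plus vs.scale_left_distrib sum.distrib)
  next
    fix a u assume "a \<in> K" "u \<in> X"
    then obtain c where "u = ?s c" "\<forall>v\<in>B. c v \<in> K" unfolding in_X by blast
    with \<open>a \<in> K\<close> show "vsmult a u \<in> X" unfolding in_X
      by (intro exI[of _ "\<lambda>v. a * c v"]) (simp add: mult vs.scale_sum_right)
  qed
  have "inj_on ?s (PiE B (\<lambda>_. K))"
  proof (rule inj_onI)
    fix c d assume cd: "c \<in> PiE B (\<lambda>_. K)" "d \<in> PiE B (\<lambda>_. K)" "?s c = ?s d"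
    then have sum0: "(\<Sum>v\<in>B. vsmult (c v - d v) v) = 0"
      by (simp add: vs.scale_left_diff_distrib sum_subtractf)
    have inK: "\<forall>v\<in>B. c v - d v \<in> K" using cd diff by (auto simp: PiE_iff)
    have "\<forall>v\<in>B. c v - d v = 0"
      by (rule mp[OF mp[OF spec[OF B(3)[unfolded K_indep_def], of "\<lambda>v. c v - d v"] inK] sum0])
    then show "c = d" using cd by (intro PiE_ext[of c B "\<lambda>_. K" d]) auto
  qed
  moreover have "?s ` PiE B (\<lambda>_. K) = X"
  proof (intro equalityI subsetI)
    fix u assume "u \<in> X"
    then obtain c where c: "u = ?s c" "\<forall>v\<in>B. c v \<in> K" unfolding in_X by blast
    then have "u = ?s (restrict c B)" by simp
    with c show "u \<in> ?s ` PiE B (\<lambda>_. K)" by (intro image_eqI[of _ _ "restrict c B"]) auto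
  qed (auto simp: in_X PiE_iff)
  ultimately have "card X = card (PiE B (\<lambda>_. K))" using card_image by blast
  then show "card X = card K ^ d" using B by (simp add: card_PiE)
qed

text \<open>Cardinality determines dimension over a finite field, so the dimension of the vertex of
  a cone can be found by counting.\<close>

lemma K_dim_UNIV_iff:
  fixes X :: "('r::finite \<Rightarrow> 'a::{finite,field}) set"
  shows "K_dim UNIV X d \<longleftrightarrow> vs.subspace X \<and> card X = CARD('a) ^ d"
proof
  assume "K_dim UNIV X d"
  from K_dim_imp_subspace_card[OF _ _ _ this] show "vs.subspace X \<and> card X = CARD('a) ^ d"
    by (simp add: K_subspace_UNIV)
next
  assume X: "vs.subspace X \<and> card X = CARD('a) ^ d"
  obtain B where B: "B \<subseteq> X" "vs.independent B" "X \<subseteq> vs.span B" by (rule vs.basis_exists)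
  have fin: "finite B" by simp
  have "vs.span B = X" using B(3) vs.span_minimal[OF B(1)] X by (intro equalityI) simp_all
  then have dim: "K_dim UNIV X (card B)"
    unfolding K_dim_def using B K_indep_UNIV[OF fin] K_span_UNIV[OF fin] fin
    by (intro exI[of _ B] conjI) simp_all
  from K_dim_imp_subspace_card(2)[OF _ _ _ this] X have "CARD('a) ^ card B = CARD('a) ^ d" by simp
  moreover have "card {0, 1::'a} \<le> CARD('a)" by (rule card_mono) auto
  ultimately have "card B = d" using power_inject_exp[of "CARD('a)"] by simp
  with dim show "K_dim UNIV X d" by simp
qed

lemma ppoint_vsmult: "c \<noteq> 0 \<Longrightarrow> ppoint (vsmult c u) = ppoint u"
proof -
  assume c: "c \<noteq> 0"
  show ?thesis unfolding ppoint_def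
  proof (intro equalityI subsetI)
    fix w assume "w \<in> {vsmult d u |d. True}"
    then obtain d where "w = vsmult d u" by blast
    with c have "w = vsmult (d / c) (vsmult c u)" by simp
    then show "w \<in> {vsmult d (vsmult c u) |d. True}" by blast
  qed auto
qed

lemma ppoint_in_Lset_iff:
  assumes "w \<noteq> 0"
  shows "ppoint w \<in> Lset X \<longleftrightarrow> (\<exists>c. c \<noteq> 0 \<and> vsmult c w \<in> X)"
proof
  assume "ppoint w \<in> Lset X"
  then obtain u where u: "u \<in> X" "u \<noteq> 0" "ppoint w = ppoint u" unfolding Lset_def by blast
  have "u \<in> ppoint u" unfolding ppoint_def by (auto intro!: exI[of _ 1])
  then obtain c where c: "u = vsmult c w" using u(3) unfolding ppoint_def by auto
  with u(2) have "c \<noteq> 0" by auto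
  with c u(1) show "\<exists>c. c \<noteq> 0 \<and> vsmult c w \<in> X" by blast
next
  assume "\<exists>c. c \<noteq> 0 \<and> vsmult c w \<in> X"
  then obtain c where c: "c \<noteq> 0" "vsmult c w \<in> X" by blast
  with assms have "vsmult c w \<in> X - {0}" by simp
  then have "ppoint (vsmult c w) \<in> Lset X" unfolding Lset_def by blast
  with ppoint_vsmult[OF c(1), of w] show "ppoint w \<in> Lset X" by simp
qed

lemma Lset_vsmult_image: "c \<noteq> 0 \<Longrightarrow> Lset (vsmult c ` X) = Lset X"
proof -
  assume c: "c \<noteq> 0"
  then have "vsmult c ` X - {0} = vsmult c ` (X - {0})" by auto
  then show ?thesis unfolding Lset_def using c by (simp add: image_image ppoint_vsmult)
qed

lemma vsmult_image_Int_subspace: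
  assumes "vs.subspace T" "c \<noteq> 0"
  shows "vsmult c ` X \<inter> T = vsmult c ` (X \<inter> T)"
proof (intro equalityI subsetI)
  fix w assume "w \<in> vsmult c ` X \<inter> T"
  then obtain u where u: "u \<in> X" "w = vsmult c u" "w \<in> T" by blast
  then have "vsmult (1 / c) w \<in> T" using vs.subspace_scale[OF assms(1)] by blast
  then have "u \<in> T" using u assms(2) by simp
  with u show "w \<in> vsmult c ` (X \<inter> T)" by blast
qed (auto intro: vs.subspace_scale[OF assms(1)])

lemma K_subspace_vsmult_image:
  assumes "K_subspace K X"
  shows "K_subspace K (vsmult c ` X)"
  unfolding K_subspace_def
proof (intro conjI ballI)
  show "0 \<in> vsmult c ` X" using assms by (intro image_eqI[of _ _ 0]) (auto simp: K_subspace_def)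
next
  fix u v assume "u \<in> vsmult c ` X" "v \<in> vsmult c ` X"
  then obtain u' v' where "u' \<in> X" "v' \<in> X" "u = vsmult c u'" "v = vsmult c v'" by blast
  then show "u + v \<in> vsmult c ` X" using assms
    by (intro image_eqI[of _ _ "u' + v'"]) (auto simp: K_subspace_def vs.scale_right_distrib)
next
  fix d v assume "d \<in> K" "v \<in> vsmult c ` X"
  then obtain v' where "v' \<in> X" "v = vsmult c v'" by blast
  then show "vsmult d v \<in> vsmult c ` X" using assms \<open>d \<in> K\<close>
    by (intro image_eqI[of _ _ "vsmult d v'"]) (auto simp: K_subspace_def mult.commute)
qed

text \<open>\<open>U\<close> is the sum of \<open>Lam\<close> and its trace on \<open>T\<close>. A
  vector a + c w of the cone with c nonzero is divided by c: \<open>Lam\<close> absorbs every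
  scalar, while w itself already lies in \<open>U\<close>.\<close>

lemma Lset_eq_cone:
  fixes U T Lam :: "('r \<Rightarrow> 'a::field) set"
  assumes add: "\<And>u v. u \<in> U \<Longrightarrow> v \<in> U \<Longrightarrow> u + v \<in> U"
    and Lam: "vs.subspace Lam" "Lam \<subseteq> U"
    and decomp: "\<And>u. u \<in> U \<Longrightarrow> \<exists>a t. a \<in> Lam \<and> t \<in> U \<inter> T \<and> u = a + t"
    and ne: "u1 \<in> U \<inter> T" "u1 \<noteq> 0"
  shows "Lset U = cone Lam (Lset (U \<inter> T))"
proof (intro equalityI subsetI)
  have self: "w \<in> ppoint w" "0 \<in> ppoint w" for w :: "'r \<Rightarrow> 'a"
    unfolding ppoint_def by (auto intro: exI[of _ 1] exI[of _ 0])
  fix p assume "p \<in> Lset U"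
  then obtain u where u: "u \<in> U" "u \<noteq> 0" "p = ppoint u" unfolding Lset_def by blast
  obtain a t where at: "a \<in> Lam" "t \<in> U \<inter> T" "u = a + t" using decomp[OF u(1)] by blast
  \<comment> \<open>A vector of the vertex alone has t = 0; any base point then does.\<close>
  define w where "w = (if t = 0 then u1 else t)"
  have w: "w \<in> U \<inter> T - {0}" using at ne by (simp add: w_def)
  have "t \<in> ppoint w" using self[of w] by (auto simp: w_def)
  then have "u \<in> {a + b |a b. a \<in> Lam \<and> b \<in> ppoint w} - {0}" using at u(2) by blast
  then have "p \<in> Lset {a + b |a b. a \<in> Lam \<and> b \<in> ppoint w}" unfolding Lset_def u(3) by (rule imageI)
  moreover have "ppoint w \<in> Lset (U \<inter> T)" unfolding Lset_def using w by (rule imageI)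
  ultimately show "p \<in> cone Lam (Lset (U \<inter> T))" unfolding cone_def by (intro UN_I)
next
  fix p assume "p \<in> cone Lam (Lset (U \<inter> T))"
  then obtain P where P: "P \<in> Lset (U \<inter> T)" "p \<in> Lset {a + b |a b. a \<in> Lam \<and> b \<in> P}"
    unfolding cone_def by (rule UN_E)
  from P(1) obtain w where w0: "w \<in> U \<inter> T" "P = ppoint w" unfolding Lset_def by auto
  from P(2) obtain a b where ab: "a \<in> Lam" "b \<in> P" "a + b \<noteq> 0" "p = ppoint (a + b)"
    unfolding Lset_def by auto
  from ab(2) w0(2) obtain c where "b = vsmult c w" unfolding ppoint_def by auto
  with ab w0 have w: "w \<in> U \<inter> T" "a \<in> Lam" "a + vsmult c w \<noteq> 0" "p = ppoint (a + vsmult c w)"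
    by simp_all
  show "p \<in> Lset U" unfolding w(4) ppoint_in_Lset_iff[OF w(3)]
  proof (cases "c = 0")
    case True
    then show "\<exists>d. d \<noteq> 0 \<and> vsmult d (a + vsmult c w) \<in> U"
      using w Lam(2) by (intro exI[of _ 1]) auto
  next
    case False
    have "vsmult (1 / c) a \<in> U" using w(2) Lam vs.subspace_scale by blast
    then have "vsmult (1 / c) a + w \<in> U" using w(1) add by blast
    then show "\<exists>d. d \<noteq> 0 \<and> vsmult d (a + vsmult c w) \<in> U"
      using False by (intro exI[of _ "1 / c"]) (simp add: vs.scale_right_distrib)
  qed
qed

lemma independent_pair_coordinates:
  fixes v0 v1 :: "'r::finite \<Rightarrow> 'a::{finite,field}"
  assumes "K_indep UNIV {v0, v1}" "v0 \<noteq> v1"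
  obtains \<alpha> \<beta> :: "('r \<Rightarrow> 'a) \<Rightarrow> 'a" where
    "\<And>u v. \<alpha> (u + v) = \<alpha> u + \<alpha> v" "\<And>c u. \<alpha> (vsmult c u) = c * \<alpha> u" "\<alpha> v0 = 1" "\<alpha> v1 = 0"
    "\<And>u v. \<beta> (u + v) = \<beta> u + \<beta> v" "\<And>c u. \<beta> (vsmult c u) = c * \<beta> u" "\<beta> v0 = 0" "\<beta> v1 = 1"
proof -
  have ind: "vs.independent {v0, v1}" using assms K_indep_UNIV[of "{v0, v1}"] by simp
  define B where "B = vs.extend_basis {v0, v1}"
  have B: "vs.independent B" "vs.span B = UNIV" "{v0, v1} \<subseteq> B"
    unfolding B_def using ind vs.independent_extend_basis vs.span_extend_basis vs.extend_basis_superset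
    by blast+
  define rep where "rep b v = vs.representation B v b" for b v
  have "rep b (u + v) = rep b u + rep b v" for b u v
    unfolding rep_def using B by (subst vs.representation_add) auto
  moreover have "rep b (vsmult c u) = c * rep b u" for b c u
    unfolding rep_def using B by (subst vs.representation_scale) auto
  moreover have "rep v0 v0 = 1" "rep v0 v1 = 0" "rep v1 v0 = 0" "rep v1 v1 = 1"
    unfolding rep_def using B assms(2) by (simp_all add: vs.representation_basis)
  ultimately show ?thesis using that[of "rep v0" "rep v1"] by blast
qed

section \<open>Subspaces as graphs over a line\<close>

text \<open>Each fibre of addition on U x T embeds in U \<inter> T by subtracting a fixed first
  component, so the count forces addition to be surjective.\<close>

lemma subspaces_span_by_card:
  fixes U T :: "('r::finite \<Rightarrow> 'a::{finite,field}) set"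
  assumes U: "\<And>u v. u \<in> U \<Longrightarrow> v \<in> U \<Longrightarrow> u - v \<in> U" and T: "\<And>u v. u \<in> T \<Longrightarrow> v \<in> T \<Longrightarrow> u - v \<in> T"
    and card: "card U * card T = CARD('r \<Rightarrow> 'a) * card (U \<inter> T)" and pos: "card (U \<inter> T) > 0"
  shows "\<exists>u\<in>U. \<exists>t\<in>T. w = u + t"
proof -
  define S where "S = (\<lambda>(u, t). u + t) ` (U \<times> T)"
  have fibre: "card {x \<in> U \<times> T. (\<lambda>(u, t). u + t) x = s} \<le> card (U \<inter> T)" for s
  proof (cases "{x \<in> U \<times> T. (\<lambda>(u, t). u + t) x = s} = {}")
    case False
    then obtain u0 t0 where 0: "u0 \<in> U" "t0 \<in> T" "u0 + t0 = s" by auto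
    show ?thesis
    proof (rule card_inj_on_le[of "\<lambda>(u, t). u - u0"])
      show "inj_on (\<lambda>(u, t). u - u0) {x \<in> U \<times> T. (\<lambda>(u, t). u + t) x = s}"
        by (auto simp: inj_on_def)
      show "(\<lambda>(u, t). u - u0) ` {x \<in> U \<times> T. (\<lambda>(u, t). u + t) x = s} \<subseteq> U \<inter> T"
      proof clarify
        fix u t assume ut: "u \<in> U" "t \<in> T" "s = u + t"
        then have "u - u0 = t0 - t" using 0 by (simp add: algebra_simps)
        then show "u - u0 \<in> U \<inter> T" using U[OF ut(1) 0(1)] T[OF 0(2) ut(2)] by simp
      qed
    qed simp
  qed (simp only: card.empty zero_le)
  have "CARD('r \<Rightarrow> 'a) * card (U \<inter> T) = card (U \<times> T)"
    using card by (simp add: card_cartesian_product)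
  also have "\<dots> = (\<Sum>s\<in>S. card {x \<in> U \<times> T. (\<lambda>(u, t). u + t) x = s})"
    unfolding card_eq_sum S_def by (rule sum.group[symmetric]) auto
  also have "\<dots> \<le> (\<Sum>s\<in>S. card (U \<inter> T))" by (rule sum_mono) (rule fibre)
  finally have "CARD('r \<Rightarrow> 'a) \<le> card S" using pos by simp
  then have "S = UNIV" by (intro card_seteq) auto
  then have "w \<in> S" by simp
  then show ?thesis unfolding S_def by auto
qed

section \<open>Coordinates adapted to the line\<close>

locale line_coordinates = finite_field_extension q n F
  for q n :: nat and F :: "'a::{finite,field} itself" +
  fixes v0 v1 :: "'r::finite \<Rightarrow> 'a" and \<alpha> \<beta> :: "('r \<Rightarrow> 'a) \<Rightarrow> 'a" and T :: "('r \<Rightarrow> 'a) set"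
  assumes \<alpha>_add: "\<And>u v. \<alpha> (u + v) = \<alpha> u + \<alpha> v" and \<alpha>_scale: "\<And>c u. \<alpha> (vsmult c u) = c * \<alpha> u"
    and \<alpha>_v: "\<alpha> v0 = 1" "\<alpha> v1 = 0"
    and \<beta>_add: "\<And>u v. \<beta> (u + v) = \<beta> u + \<beta> v" and \<beta>_scale: "\<And>c u. \<beta> (vsmult c u) = c * \<beta> u"
    and \<beta>_v: "\<beta> v0 = 0" "\<beta> v1 = 1"
    and subspace_T: "vs.subspace T" and v_in_T: "v0 \<in> T" "v1 \<in> T" and card_T: "card T = (q ^ n) ^ 2"
begin

lemma additive_\<alpha>: "additive \<alpha>" and additive_\<beta>: "additive \<beta>"
  by (simp_all add: additive_def \<alpha>_add \<beta>_add)

definition pt :: "'a \<Rightarrow> 'a \<Rightarrow> ('r \<Rightarrow> 'a)" where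
  "pt x y = vsmult x v0 + vsmult y v1"

lemma \<alpha>_pt [simp]: "\<alpha> (pt x y) = x" and \<beta>_pt [simp]: "\<beta> (pt x y) = y"
  by (simp_all add: pt_def \<alpha>_add \<beta>_add \<alpha>_scale \<beta>_scale \<alpha>_v \<beta>_v)

lemma pt_in_T: "pt x y \<in> T"
  unfolding pt_def using vs.subspace_add[OF subspace_T] vs.subspace_scale[OF subspace_T] v_in_T by blast

lemma pt_add: "pt x y + pt x' y' = pt (x + x') (y + y')"
  by (simp add: pt_def vs.scale_left_distrib)

lemma vsmult_pt: "vsmult c (pt x y) = pt (c * x) (c * y)"
  by (simp add: pt_def vs.scale_right_distrib)

lemma pt_eq_0_iff: "pt x y = 0 \<longleftrightarrow> x = 0 \<and> y = 0"
proof
  assume "pt x y = 0"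
  then have "\<alpha> (pt x y) = 0" "\<beta> (pt x y) = 0"
    using additive.zero[OF additive_\<alpha>] additive.zero[OF additive_\<beta>] by simp_all
  then show "x = 0 \<and> y = 0" by simp
qed (simp add: pt_def)

lemma T_eq: "u \<in> T \<Longrightarrow> u = pt (\<alpha> u) (\<beta> u)"
proof -
  have inj: "inj (\<lambda>(x, y). pt x y)"
    by (rule inj_on_inverseI[of _ "\<lambda>u. (\<alpha> u, \<beta> u)"]) auto
  have "card (range (\<lambda>(x, y). pt x y)) = card T"
    using card_image[OF inj] card_T card_field
    by (simp add: card_cartesian_product power2_eq_square flip: UNIV_Times_UNIV)
  then have "range (\<lambda>(x, y). pt x y) = T" by (intro card_subset_eq) (auto simp: pt_in_T)
  moreover assume "u \<in> T"
  ultimately obtain x y where "u = pt x y" by auto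
  then show ?thesis by simp
qed

lemma minus_one_fixed: "(- 1 :: 'a) ^ q = - 1"
  using additive.minus[OF frobenius_additive[of 1], of 1] by simp

lemma K_subspace_diff:
  assumes "K_subspace (subfield_of_order q) X" "u \<in> X" "v \<in> X"
  shows "u - v \<in> (X :: ('r \<Rightarrow> 'a) set)"
proof -
  have "vsmult (- 1) v \<in> X" using assms minus_one_fixed by (auto simp: K_subspace_def subfield_of_order_def)
  then have "u + vsmult (- 1) v \<in> X" using assms by (auto simp: K_subspace_def)
  then show ?thesis by simp
qed

text \<open>No point with first coordinate 0 lies in the linear set, so \<alpha> is injective on
  \<open>X\<close>, and by cardinality \<open>X\<close> is the graph of a function f. Equality of
  directions then makes f a monomial.\<close>

lemma pseudoregulus_subspace_form:
  assumes X: "K_subspace (subfield_of_order q) X" "X \<subseteq> T" "card X = q ^ n"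
    and i: "coprime i n" and L: "Lset X = Lset {pt \<mu> (\<mu> ^ (q ^ i)) |\<mu>. True}"
  obtains k e where "coprime k n" "e \<noteq> 0" "X = vsmult e ` {pt \<mu> (\<mu> ^ (q ^ k)) |\<mu>. True}"
proof -
  have dir: "(\<exists>c. c \<noteq> 0 \<and> pt (c * x) (c * y) \<in> X) \<longleftrightarrow> (\<exists>c. c \<noteq> 0 \<and> c * y = (c * x) ^ (q ^ i))"
    if "x \<noteq> 0 \<or> y \<noteq> 0" for x y
  proof -
    have "pt x y \<noteq> 0" using that by (simp add: pt_eq_0_iff)
    from ppoint_in_Lset_iff[OF this, of X] ppoint_in_Lset_iff[OF this, of "{pt \<mu> (\<mu> ^ (q ^ i)) |\<mu>. True}"]
    have "(\<exists>c. c \<noteq> 0 \<and> pt (c * x) (c * y) \<in> X) \<longleftrightarrow> (\<exists>c. c \<noteq> 0 \<and> pt (c * x) (c * y) \<in> {pt \<mu> (\<mu> ^ (q ^ i)) |\<mu>. True})"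
      by (simp add: L vsmult_pt)
    moreover have "pt a b \<in> {pt \<mu> (\<mu> ^ (q ^ i)) |\<mu>. True} \<longleftrightarrow> b = a ^ (q ^ i)" for a b
    proof
      assume "pt a b \<in> {pt \<mu> (\<mu> ^ (q ^ i)) |\<mu>. True}"
      then obtain \<mu> where "pt a b = pt \<mu> (\<mu> ^ (q ^ i))" by blast
      then show "b = a ^ (q ^ i)" using \<alpha>_pt \<beta>_pt by metis
    qed blast
    ultimately show ?thesis by simp
  qed
  have inj: "inj_on \<alpha> X"
  proof (rule inj_onI, rule ccontr)
    fix u v assume uv: "u \<in> X" "v \<in> X" "\<alpha> u = \<alpha> v" "u \<noteq> v"
    define w where "w = u - v"
    have w: "w \<in> X" "w \<noteq> 0" "\<alpha> w = 0"
      using uv K_subspace_diff[OF X(1)] additive.diff[OF additive_\<alpha>] by (auto simp: w_def)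
    then have w_eq: "w = pt 0 (\<beta> w)" using T_eq[of w] X(2) by auto
    then have b: "\<beta> w \<noteq> 0" using w(2) by (metis pt_eq_0_iff)
    have "\<exists>c. c \<noteq> 0 \<and> pt (c * 0) (c * \<beta> w) \<in> X" using w(1) w_eq by (intro exI[of _ 1]) simp
    with dir[of 0 "\<beta> w"] b show False by auto
  qed
  have "\<alpha> ` X = UNIV"
    using card_image[OF inj] X(3) card_field by (intro card_seteq) auto
  define f where "f x = \<beta> (inv_into X \<alpha> x)" for x
  have \<alpha>_inv: "\<alpha> (inv_into X \<alpha> x) = x" and inv_X: "inv_into X \<alpha> x \<in> X" for x
    using \<open>\<alpha> ` X = UNIV\<close> by (simp_all add: f_inv_into_f inv_into_into)
  have mem: "pt x y \<in> X \<longleftrightarrow> y = f x" for x y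
  proof -
    have "pt x (f x) = inv_into X \<alpha> x"
      using T_eq[of "inv_into X \<alpha> x"] X(2) inv_X[of x] \<alpha>_inv[of x] by (auto simp: f_def)
    then have fX: "pt x (f x) \<in> X" using inv_X by simp
    show ?thesis
    proof
      assume "pt x y \<in> X"
      then have "pt x y = pt x (f x)" using inj_onD[OF inj] fX by simp
      then show "y = f x" using \<beta>_pt by metis
    qed (use fX in simp)
  qed
  have f_add: "additive f"
  proof
    fix x y
    have "pt x (f x) + pt y (f y) \<in> X" using X(1) mem by (simp add: K_subspace_def)
    then show "f (x + y) = f x + f y" using mem by (simp add: pt_add)
  qed
  have f_lin: "f (c * x) = c * f x" if "c ^ q = c" for c x
  proof -
    have "vsmult c (pt x (f x)) \<in> X" using X(1) mem that by (simp add: K_subspace_def subfield_of_order_def)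
    then show ?thesis using mem by (simp add: vsmult_pt)
  qed
  have "(\<exists>x. x \<noteq> 0 \<and> f x = b * x) \<longleftrightarrow> (\<exists>x. x \<noteq> 0 \<and> x ^ (q ^ i) = b * x)" for b
  proof -
    have swap: "x * b = y \<longleftrightarrow> y = b * x" for x y :: 'a by (auto simp: mult.commute)
    show ?thesis using dir[of 1 b] by (simp add: mem swap)
  qed
  then obtain k e where ke: "coprime k n" "e \<noteq> 0" "\<And>x. f x = e * (x / e) ^ (q ^ k)"
    using direction_set_determines_monomial[OF i f_add f_lin] by blast
  have "X = vsmult e ` {pt \<mu> (\<mu> ^ (q ^ k)) |\<mu>. True}"
  proof (intro equalityI subsetI)
    fix u assume "u \<in> X"
    then have u: "u = pt (\<alpha> u) (f (\<alpha> u))" using T_eq X(2) mem by (metis subsetD)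
    then have "u = vsmult e (pt (\<alpha> u / e) ((\<alpha> u / e) ^ (q ^ k)))"
      using ke by (simp add: vsmult_pt)
    then show "u \<in> vsmult e ` {pt \<mu> (\<mu> ^ (q ^ k)) |\<mu>. True}" by blast
  next
    fix u assume "u \<in> vsmult e ` {pt \<mu> (\<mu> ^ (q ^ k)) |\<mu>. True}"
    then obtain \<mu> where "u = vsmult e (pt \<mu> (\<mu> ^ (q ^ k)))" by blast
    then show "u \<in> X" using ke by (simp add: vsmult_pt mem)
  qed
  with ke that show ?thesis by blast
qed

text \<open>\<open>U\<close> and \<open>T\<close> together span the space, and the defect \<beta> -
  \<alpha>^(q^k) vanishes on U \<inter> T. On \<open>U\<close> the defect therefore depends only on
  the class modulo \<open>T\<close>, and \<open>G\<close> is the function it induces on the whole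
  space.\<close>

lemma subspace_as_graph:
  assumes U: "K_subspace (subfield_of_order q) U" and card: "card U * q ^ n = CARD('r \<Rightarrow> 'a)"
    and UT: "U \<inter> T = {pt \<mu> (\<mu> ^ (q ^ k)) |\<mu>. True}"
  obtains G :: "('r \<Rightarrow> 'a) \<Rightarrow> 'a" where
    "\<And>u v. G (u + v) = G u + G v" "\<And>c u. c ^ q = c \<Longrightarrow> G (vsmult c u) = c * G u"
    "\<And>x y. G (pt x y) = 0" "\<And>u. u \<in> U \<longleftrightarrow> \<beta> u = \<alpha> u ^ (q ^ k) + G u"
proof -
  have card_UT: "card (U \<inter> T) = q ^ n"
  proof -
    have "U \<inter> T = range (\<lambda>\<mu>. pt \<mu> (\<mu> ^ (q ^ k)))" using UT by auto
    moreover have "inj (\<lambda>\<mu>. pt \<mu> (\<mu> ^ (q ^ k)))" by (rule inj_on_inverseI[of _ \<alpha>]) simp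
    ultimately show ?thesis using card_image card_field by metis
  qed
  have span: "\<exists>u\<in>U. \<exists>t\<in>T. w = u + t" for w
  proof (rule subspaces_span_by_card)
    show "card U * card T = CARD('r \<Rightarrow> 'a) * card (U \<inter> T)"
      unfolding card_T card_UT card[symmetric] by (simp add: power2_eq_square mult.assoc)
    show "card (U \<inter> T) > 0" unfolding card_UT by (rule q_power_pos)
  qed (use K_subspace_diff[OF U] vs.subspace_diff[OF subspace_T] in blast)+
  define \<delta> where "\<delta> u = \<beta> u - \<alpha> u ^ (q ^ k)" for u
  have \<delta>_diff: "\<delta> (u - v) = \<delta> u - \<delta> v" and \<delta>_add: "\<delta> (u + v) = \<delta> u + \<delta> v" for u v
    by (simp_all add: \<delta>_def additive.diff[OF additive_\<beta>] additive.diff[OF additive_\<alpha>] \<beta>_add \<alpha>_add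
        additive.diff[OF frobenius_additive] frobenius_add)
  have \<delta>_scale: "\<delta> (vsmult c u) = c * \<delta> u" if "c ^ q = c" for c u
  proof -
    have "c ^ (q ^ k) = c" by (induction k) (simp_all add: that power_mult)
    then show ?thesis by (simp add: \<delta>_def \<beta>_scale \<alpha>_scale power_mult_distrib right_diff_distrib)
  qed
  have \<delta>_UT: "t \<in> U \<longleftrightarrow> \<delta> t = 0" if t: "t \<in> T" for t
  proof
    assume "t \<in> U"
    then obtain \<mu> where "t = pt \<mu> (\<mu> ^ (q ^ k))" using t UT by blast
    then show "\<delta> t = 0" by (simp add: \<delta>_def)
  next
    assume "\<delta> t = 0"
    then have "t = pt (\<alpha> t) (\<alpha> t ^ (q ^ k))" using T_eq[OF t] by (simp add: \<delta>_def)
    then show "t \<in> U" using UT by blast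
  qed
  \<comment> \<open>Any u in \<open>U\<close> congruent to w modulo \<open>T\<close> may be chosen,
    since two choices differ by an element of U \<inter> T.\<close>
  define G where "G w = \<delta> (SOME u. u \<in> U \<and> u - w \<in> T)" for w
  have G: "G w = \<delta> u" if u: "u \<in> U" "u - w \<in> T" for u w
  proof -
    define u' where "u' = (SOME u. u \<in> U \<and> u - w \<in> T)"
    have u': "u' \<in> U" "u' - w \<in> T" using someI[of "\<lambda>u. u \<in> U \<and> u - w \<in> T" u] u by (simp_all add: u'_def)
    have "u' - u \<in> U" using u' u K_subspace_diff[OF U] by blast
    moreover have "u' - u \<in> T" using vs.subspace_diff[OF subspace_T u'(2) u(2)] by simp
    ultimately have "\<delta> (u' - u) = 0" using \<delta>_UT by blast
    then show ?thesis by (simp add: G_def u'_def \<delta>_diff)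
  qed
  have rep: "\<exists>u. u \<in> U \<and> u - w \<in> T" for w
  proof -
    obtain u t where ut: "u \<in> U" "t \<in> T" "w = u + t" using span by blast
    then have "u - w = - t" by simp
    then show ?thesis using ut vs.subspace_neg[OF subspace_T] by metis
  qed
  show ?thesis
  proof (rule that[of G])
    fix u v
    obtain u' v' where uv: "u' \<in> U" "u' - u \<in> T" "v' \<in> U" "v' - v \<in> T" using rep by meson
    then have "u' + v' \<in> U" using U by (simp add: K_subspace_def)
    moreover have "(u' + v') - (u + v) \<in> T"
      using vs.subspace_add[OF subspace_T uv(2,4)] by (simp add: algebra_simps)
    ultimately show "G (u + v) = G u + G v" using G uv \<delta>_add by metis
  next
    fix c :: 'a and u assume c: "c ^ q = c"
    obtain u' where u: "u' \<in> U" "u' - u \<in> T" using rep by meson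
    then have "vsmult c u' \<in> U" using U c by (simp add: K_subspace_def subfield_of_order_def)
    moreover have "vsmult c u' - vsmult c u \<in> T"
      using vs.subspace_scale[OF subspace_T u(2), of c] by (simp add: vs.scale_right_diff_distrib)
    ultimately show "G (vsmult c u) = c * G u" using G u \<delta>_scale[OF c] by metis
  next
    fix x y
    have "0 \<in> U" using U by (simp add: K_subspace_def)
    moreover have "0 - pt x y \<in> T" using vs.subspace_neg[OF subspace_T pt_in_T] by simp
    ultimately have "G (pt x y) = \<delta> 0" by (rule G)
    then show "G (pt x y) = 0" using \<delta>_diff[of 0 0] by simp
  next
    fix w
    obtain u where u: "u \<in> U" "u - w \<in> T" using rep by meson
    have "w \<in> U \<longleftrightarrow> u - w \<in> U"
      using K_subspace_diff[OF U u(1), of w] K_subspace_diff[OF U u(1), of "u - w"] by auto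
    also have "\<dots> \<longleftrightarrow> \<delta> w = G w" using \<delta>_UT[OF u(2)] G[OF u] \<delta>_diff[of u w] by auto
    finally show "w \<in> U \<longleftrightarrow> \<beta> w = \<alpha> w ^ (q ^ k) + G w" by (auto simp: \<delta>_def algebra_simps)
  qed
qed

end

section \<open>Cones\<close>

locale conjugate_graph = line_coordinates q n F v0 v1 \<alpha> \<beta> T + conjugation q n F j
  for q n :: nat and F :: "'a::{finite,field} itself"
    and v0 v1 :: "'r::finite \<Rightarrow> 'a" and \<alpha> \<beta> :: "('r \<Rightarrow> 'a) \<Rightarrow> 'a" and T :: "('r \<Rightarrow> 'a) set" and j :: nat +
  fixes G :: "('r \<Rightarrow> 'a) \<Rightarrow> 'a" and U :: "('r \<Rightarrow> 'a) set"
  assumes G_add: "\<And>u v. G (u + v) = G u + G v"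
    and G_scale: "\<And>c u. c ^ q = c \<Longrightarrow> G (vsmult c u) = c * G u"
    and G_pt: "\<And>x y. G (pt x y) = 0"
    and U_iff: "\<And>u. u \<in> U \<longleftrightarrow> \<beta> u = \<alpha> u ^ \<sigma> + G u"
begin

lemma additive_G: "additive G" by (simp add: additive_def G_add)

lemma additive_line: "additive (\<lambda>x. G (vsmult x v))"
  by (simp add: additive_def G_add vs.scale_left_distrib)

lemma line_scale: "c ^ q = c \<Longrightarrow> G (vsmult (c * x) v) = c * G (vsmult x v)"
  using G_scale[of c "vsmult x v"] by simp

lemma \<sigma>_add1: "(x + y :: 'a) ^ \<sigma> = x ^ \<sigma> + y ^ \<sigma>" using \<sigma>_add[of x y 1] by simp

lemma \<sigma>_minus1: "(- x :: 'a) ^ \<sigma> = - (x ^ \<sigma>)" using additive.minus[OF \<sigma>_additive[of 1], of x] by simp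

lemma U_add: "u \<in> U \<Longrightarrow> v \<in> U \<Longrightarrow> u + v \<in> U"
  by (simp add: U_iff \<beta>_add \<alpha>_add G_add \<sigma>_add1)

lemma conj_coeff_line_add:
  "conj_coeff j i (\<lambda>x. G (vsmult x (u + v))) = conj_coeff j i (\<lambda>x. G (vsmult x u)) + conj_coeff j i (\<lambda>x. G (vsmult x v))"
  by (simp add: conj_coeff_def vs.scale_right_distrib G_add add_divide_distrib sum.distrib)

text \<open>Substitute y = x c in the defining sum. As functions of v, the coefficient of index 0 is
  thus linear and that of index 1 is \<sigma>-semilinear.\<close>

lemma conj_coeff_line_scale:
  "conj_coeff j i (\<lambda>x. G (vsmult x (vsmult c v))) = c ^ (\<sigma> ^ i) * conj_coeff j i (\<lambda>x. G (vsmult x v))"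
proof (cases "c = 0")
  case True
  moreover have "(0::'a) ^ (\<sigma> ^ i) = 0" by (simp only: \<sigma>_eq_0_iff)
  ultimately show ?thesis using additive.zero[OF additive_G] by (simp add: conj_coeff_def)
next
  case False
  have "(\<Sum>x\<in>-{0}. G (vsmult x (vsmult c v)) / x ^ (\<sigma> ^ i)) = (\<Sum>y\<in>-{0}. c ^ (\<sigma> ^ i) * (G (vsmult y v) / y ^ (\<sigma> ^ i)))"
    by (rule sum.reindex_bij_witness[of _ "\<lambda>y. y / c" "\<lambda>x. x * c"])
      (use False in \<open>auto simp: power_mult_distrib\<close>)
  then show ?thesis by (simp add: conj_coeff_def sum_distrib_left flip: \<sigma>_def)
qed

lemma conj_coeff_line_pt: "conj_coeff j i (\<lambda>z. G (vsmult z (pt x y))) = 0"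
  by (simp add: conj_coeff_def vsmult_pt G_pt)

text \<open>If every \<open>G (x v)\<close> is of the form \<open>g\<^sub>0 x + g\<^sub>1 x\<^sup>\<sigma>\<close>, then \<open>G = g\<^sub>0 + h\<^sup>\<sigma>\<close> for linear forms
  \<open>g\<^sub>0\<close> and \<open>h\<close>, so \<open>U\<close> is given by \<open>\<beta> - g\<^sub>0 = (\<alpha> + h)\<^sup>\<sigma>\<close>, and the common kernel of
  \<open>\<alpha> + h\<close> and \<open>\<beta> - g\<^sub>0\<close> is the vertex of the cone.\<close>

lemma graph_cone:
  assumes "\<And>v m. 1 \<le> m \<Longrightarrow> Suc m < n \<Longrightarrow> \<gamma> m (\<lambda>x. G (vsmult x v)) = 0"
  shows "\<exists>Lam. K_dim UNIV Lam (CARD('r) - 2) \<and> Lam \<inter> T = {0} \<and> Lset U = cone Lam (Lset (U \<inter> T))"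
proof -
  define g0 where "g0 v = conj_coeff j 0 (\<lambda>x. G (vsmult x v))" for v
  define g1 where "g1 v = conj_coeff j 1 (\<lambda>x. G (vsmult x v))" for v
  \<comment> \<open>On the field, \<sigma>^(n - 1) inverts \<sigma>, which turns the semilinear
    \<open>g1\<close> into a linear form.\<close>
  define h where "h v = g1 v ^ (\<sigma> ^ (n - 1))" for v
  have G_eq: "G v = g0 v + g1 v" for v
  proof -
    have "G (vsmult 1 v) = g0 v * 1 + g1 v * 1 ^ \<sigma>"
      unfolding g0_def g1_def by (rule two_term_expansion[OF additive_line line_scale assms])
    then show ?thesis by simp
  qed
  have conj_back: "(x ^ (\<sigma> ^ (n - 1))) ^ \<sigma> = x" "(x ^ \<sigma>) ^ (\<sigma> ^ (n - 1)) = x" for x :: 'a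
    using \<sigma>_n[of x] n_pos power_Suc[of \<sigma> "n - 1"] by (simp_all add: mult.commute flip: power_mult)
  have h_conj: "h v ^ \<sigma> = g1 v" for v unfolding h_def by (rule conj_back)
  have g0: "g0 (u + v) = g0 u + g0 v" "g0 (vsmult c v) = c * g0 v" for u v c
    unfolding g0_def conj_coeff_line_add conj_coeff_line_scale by simp_all
  have h: "h (u + v) = h u + h v" "h (vsmult c v) = c * h v" for u v c
    unfolding h_def g1_def conj_coeff_line_add conj_coeff_line_scale \<sigma>_add power_mult_distrib
      power_one_right conj_back by (rule refl)+
  have g0_pt: "g0 (pt x y) = 0" and h_pt: "h (pt x y) = 0" for x y
    unfolding g0_def h_def g1_def conj_coeff_line_pt \<sigma>_eq_0_iff by (rule refl)+
  define Lam where "Lam = {w. \<alpha> w = - h w \<and> \<beta> w = g0 w}"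
  have zero: "\<alpha> 0 = 0" "\<beta> 0 = 0" "h 0 = 0" "g0 0 = 0"
    using \<alpha>_scale[of 0 0] \<beta>_scale[of 0 0] h(2)[of 0 0] g0(2)[of 0 0] by simp_all
  have sub: "vs.subspace Lam"
    unfolding vs.subspace_def Lam_def by (simp add: zero \<alpha>_add \<beta>_add \<alpha>_scale \<beta>_scale h g0)
  have LT: "t = 0" if t: "t \<in> Lam" "t \<in> T" for t
  proof -
    have "h t = 0" "g0 t = 0" using T_eq[OF t(2)] h_pt g0_pt by metis+
    then have "\<alpha> t = 0" "\<beta> t = 0" using t(1) by (auto simp: Lam_def)
    then have "t = pt 0 0" using T_eq[OF t(2)] by simp
    then show ?thesis by (simp add: pt_eq_0_iff)
  qed
  have dec: "\<exists>a t. a \<in> Lam \<and> t \<in> T \<and> w = a + t" for w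
  proof -
    \<comment> \<open>The projection of w to \<open>T\<close> along \<open>Lam\<close>: h and g0
      vanish on \<open>T\<close>, so w - t satisfies both equations of \<open>Lam\<close>.\<close>
    define t where "t = pt (\<alpha> w + h w) (\<beta> w - g0 w)"
    have "h (w - t) + h t = h w" "g0 (w - t) + g0 t = g0 w" "\<alpha> (w - t) + \<alpha> t = \<alpha> w" "\<beta> (w - t) + \<beta> t = \<beta> w"
      by (simp_all flip: h g0 \<alpha>_add \<beta>_add)
    then have "w - t \<in> Lam" by (simp add: Lam_def t_def h_pt g0_pt algebra_simps eq_neg_iff_add_eq_0)
    moreover have "t \<in> T" by (simp add: t_def pt_in_T)
    ultimately show ?thesis by (intro exI[of _ "w - t"] exI[of _ t]) simp
  qed
  have "card Lam * card T = CARD('r \<Rightarrow> 'a)"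
  proof -
    have "inj_on (\<lambda>(a, t). a + t) (Lam \<times> T)"
    proof (rule inj_onI, clarify)
      fix a t a' t' assume *: "a \<in> Lam" "t \<in> T" "a' \<in> Lam" "t' \<in> T" "a + t = a' + t'"
      then have "a - a' = t' - t" by (simp add: algebra_simps)
      then have "a - a' = 0"
        using LT[of "a - a'"] vs.subspace_diff[OF sub *(1,3)] vs.subspace_diff[OF subspace_T *(4,2)] by simp
      with * show "a = a' \<and> t = t'" by simp
    qed
    moreover have "w \<in> (\<lambda>(a, t). a + t) ` (Lam \<times> T)" for w
    proof -
      obtain a t where "a \<in> Lam" "t \<in> T" "w = a + t" using dec by blast
      then show ?thesis by (intro image_eqI[of _ _ "(a, t)"]) simp_all
    qed
    then have "(\<lambda>(a, t). a + t) ` (Lam \<times> T) = UNIV" by blast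
    ultimately show ?thesis using card_image[of "\<lambda>(a, t). a + t" "Lam \<times> T"] by (simp add: card_cartesian_product)
  qed
  then have "card Lam * CARD('a) ^ 2 = CARD('a) ^ CARD('r)" by (simp add: card_fun card_T card_field)
  \<comment> \<open>This makes the natural number subtraction in the dimension of the vertex
    exact.\<close>
  moreover have "CARD('r) \<ge> 2"
  proof (rule ccontr)
    assume "\<not> ?thesis"
    then have "CARD('a) ^ CARD('r) < CARD('a) ^ 2"
      using card_field card_field_gt_1 by (intro power_strict_increasing) auto
    moreover have "card Lam > 0" using sub vs.subspace_0 by (auto simp: card_gt_0_iff)
    then have "1 * CARD('a) ^ 2 \<le> card Lam * CARD('a) ^ 2" by (intro mult_le_mono1) simp
    ultimately show False using \<open>card Lam * CARD('a) ^ 2 = _\<close> by simp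
  qed
  then obtain m where "CARD('r) = 2 + m" using le_Suc_ex by blast
  ultimately have "card Lam = CARD('a) ^ (CARD('r) - 2)" by (simp only: power_add) simp
  then have dim: "K_dim UNIV Lam (CARD('r) - 2)" using sub K_dim_UNIV_iff by blast
  have "Lam \<inter> T = {0}" using LT vs.subspace_0[OF sub] vs.subspace_0[OF subspace_T] by auto
  moreover have "Lset U = cone Lam (Lset (U \<inter> T))"
  proof (rule Lset_eq_cone[OF U_add sub])
    show LU: "Lam \<subseteq> U" by (auto simp: Lam_def U_iff G_eq \<sigma>_minus1 h_conj)
    show "pt 1 1 \<in> U \<inter> T" by (simp add: U_iff G_pt pt_in_T)
    show "pt 1 1 \<noteq> 0" by (simp add: pt_eq_0_iff)
    fix u assume u: "u \<in> U"
    obtain a t where at: "a \<in> Lam" "t \<in> T" "u = a + t" using dec by blast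
    have "t = u + vsmult (- 1) a" using at by simp
    moreover have "vsmult (- 1) a \<in> U" using LU vs.subspace_scale[OF sub at(1)] by blast
    ultimately have "t \<in> U" using U_add[OF u] by (simp only:)
    with at show "\<exists>a t. a \<in> Lam \<and> t \<in> U \<inter> T \<and> u = a + t" by blast
  qed
  ultimately show ?thesis using dim by blast
qed

text \<open>If the \<gamma> m with 1 <= m <= n - 2 vanish along every vector,
  \<open>graph_cone\<close> applies. Otherwise a vector v with a nonzero value forces t = 1 and,
  through \<open>cone_type_or_equal\<close>, G = H everywhere.\<close>

lemma graphs_equal_or_cone:
  fixes H :: "('r \<Rightarrow> 'a) \<Rightarrow> 'a" and W :: "('r \<Rightarrow> 'a) set"
  assumes H_add: "\<And>u v. H (u + v) = H u + H v"
    and H_scale: "\<And>c u. c ^ q = c \<Longrightarrow> H (vsmult c u) = c * H u"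
    and H_pt: "\<And>x y. H (pt x y) = 0"
    and W_iff: "\<And>u. u \<in> W \<longleftrightarrow> \<beta> u = \<alpha> u ^ (\<sigma> ^ t) + H u"
    and L: "Lset U = Lset W" and t: "0 < t" "t < n"
  shows "U = W \<or> (\<exists>Lam. K_dim UNIV Lam (CARD('r) - 2) \<and> Lam \<inter> T = {0} \<and> Lset U = cone Lam (Lset (U \<inter> T)))"
proof -
  let ?G = "\<lambda>v x. G (vsmult x v)" and ?H = "\<lambda>v x. H (vsmult x v)"
  have addH: "additive (?H v)" for v by (simp add: additive_def H_add vs.scale_left_distrib)
  have linH: "c ^ q = c \<Longrightarrow> ?H v (c * x) = c * ?H v x" for c v x
    using H_scale[of c "vsmult x v"] by simp
  have dir: "(\<exists>c. c \<noteq> 0 \<and> c * b = (c * a) ^ (\<sigma> ^ 1) + ?G v c) \<longleftrightarrow>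
             (\<exists>c. c \<noteq> 0 \<and> c * b = (c * a) ^ (\<sigma> ^ t) + ?H v c)" for a b v
  proof -
    \<comment> \<open>w has the prescribed coordinates a and b. It differs from v by an element of
      the line, on whose multiples \<open>G\<close> and \<open>H\<close> vanish.\<close>
    define w where "w = v + pt (a - \<alpha> v) (b - \<beta> v)"
    have w: "\<alpha> w = a" "\<beta> w = b" by (simp_all add: w_def \<alpha>_add \<beta>_add)
    have Gw: "G (vsmult c w) = ?G v c" and Hw: "H (vsmult c w) = ?H v c" for c
      by (simp_all add: w_def vs.scale_right_distrib G_add H_add vsmult_pt G_pt H_pt)
    have memU: "vsmult c w \<in> U \<longleftrightarrow> c * b = (c * a) ^ (\<sigma> ^ 1) + ?G v c" for c
      by (simp add: U_iff \<alpha>_scale \<beta>_scale w Gw)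
    have memW: "vsmult c w \<in> W \<longleftrightarrow> c * b = (c * a) ^ (\<sigma> ^ t) + ?H v c" for c
      by (simp add: W_iff \<alpha>_scale \<beta>_scale w Hw)
    show ?thesis
    proof (cases "w = 0")
      case True
      have "0 \<in> U" "0 \<in> W"
        using additive.zero[OF additive_\<alpha>] additive.zero[OF additive_\<beta>] additive.zero[OF additive_G]
          H_pt[of 0 0] pt_eq_0_iff[of 0 0] \<sigma>_eq_0_iff[of 0] \<sigma>_eq_0_iff[of 0 1] by (simp_all add: U_iff W_iff)
      then have "vsmult 1 w \<in> U" "vsmult 1 w \<in> W" using True by simp_all
      then show ?thesis unfolding memU memW using zero_neq_one by metis
    next
      case False
      from ppoint_in_Lset_iff[OF this, of U] ppoint_in_Lset_iff[OF this, of W] L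
      show ?thesis unfolding memU memW by simp
    qed
  qed
  show ?thesis
  proof (cases "\<forall>v m. 1 \<le> m \<longrightarrow> Suc m < n \<longrightarrow> \<gamma> m (?G v) = 0")
    case True
    then show ?thesis using graph_cone by blast
  next
    case False
    then obtain v m where m: "1 \<le> m" "Suc m < n" and ne: "\<gamma> m (?G v) \<noteq> 0" by blast
    have t1: "t = 1"
      using \<gamma>_vanishes[OF additive_line addH dir m(2,1) t] ne by blast
    have eq: "G u = H u" if "\<gamma> m (?G u) \<noteq> 0" for u
      using cone_type_or_equal[OF additive_line addH dir t1 line_scale linH m(2,1) that, of 1] by simp
    have "G z = H z" for z
    proof (cases "\<gamma> m (?G z) = 0")
      case True
      \<comment> \<open>Where \<gamma> m vanishes at z, it is nonzero at z + v, and additivity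
        recovers G z = H z from the values at v and z + v.\<close>
      have "?G (z + v) = (\<lambda>x. ?G z x + ?G v x)" by (simp add: vs.scale_right_distrib G_add)
      then have "\<gamma> m (?G (z + v)) = \<gamma> m (?G z) + \<gamma> m (?G v)" by (simp only: \<gamma>_add)
      then have "G (z + v) = H (z + v)" using True ne by (intro eq) simp
      then show ?thesis using eq[OF ne] by (simp add: G_add H_add)
    qed (rule eq)
    then have "U = W" by (auto simp: U_iff W_iff t1)
    then show ?thesis ..
  qed
qed

end

section \<open>Normalisation of the two subspaces and conclusion\<close>

lemma Lset_eq_imp_subspace_subset:
  fixes U W :: "('r \<Rightarrow> 'a::field) set"
  assumes "vs.subspace U" "vs.subspace W" "Lset U = Lset W"
  shows "U \<subseteq> W"
proof
  fix u assume u: "u \<in> U"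
  show "u \<in> W"
  proof (cases "u = 0")
    case False
    then have "ppoint u \<in> Lset W" using u assms(3) by (auto simp: Lset_def)
    then obtain c where c: "c \<noteq> 0" "vsmult c u \<in> W" using ppoint_in_Lset_iff[OF False] by blast
    from vs.subspace_scale[OF assms(2) c(2), of "1 / c"] c(1) show ?thesis by simp
  qed (use assms vs.subspace_0 in auto)
qed

context finite_field_extension
begin

lemma K_dim_base_field:
  fixes X :: "('r \<Rightarrow> 'a) set"
  assumes "K_dim (subfield_of_order q) X d"
  shows "K_subspace (subfield_of_order q) X" "card X = q ^ d"
proof -
  have diff: "(x - y) ^ q = x ^ q - y ^ q" for x y :: 'a
    using additive.diff[OF frobenius_additive[of 1], of x y] by simp
  have "(0::'a) \<in> subfield_of_order q" using q_ge_2 by (simp add: subfield_of_order_def)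
  moreover have "x - y \<in> subfield_of_order q" "x * y \<in> subfield_of_order q"
    if "x \<in> subfield_of_order q" "y \<in> subfield_of_order q" for x y :: 'a
    using that by (simp_all add: subfield_of_order_def diff power_mult_distrib)
  ultimately show "K_subspace (subfield_of_order q) X" "card X = q ^ d"
    using K_dim_imp_subspace_card[OF _ _ _ assms] card_base_field by simp_all
qed

lemma power_fixed_iterate: "(c::'a) ^ (q ^ e) = c \<Longrightarrow> c ^ (q ^ (e * k)) = c"
  by (induction k) (simp_all add: power_add power_mult)

text \<open>The parametrised set is a subspace over the field of order q^gcd(i, n), on which x ->
  x^(q^i) is the identity; maximality of the field of linearity makes the gcd 1.\<close>

lemma pseudoregulus_exponent_coprime:
  fixes v0 v1 :: "'r \<Rightarrow> 'a"
  assumes "max_linearity_exp q n (Lset {vsmult \<mu> v0 + vsmult (\<mu> ^ (q ^ i)) v1 |\<mu>. True}) = 1"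
  shows "coprime i n"
proof -
  let ?X = "{vsmult \<mu> v0 + vsmult (\<mu> ^ (q ^ i)) v1 |\<mu>. True}"
  let ?P = "\<lambda>e. e dvd n \<and> (\<exists>X. K_subspace (subfield_of_order (q ^ e)) X \<and> Lset ?X = Lset X)"
  define e where "e = gcd i n"
  obtain k where k: "i = e * k" unfolding e_def by (meson dvdE gcd_dvd1)
  have "K_subspace (subfield_of_order (q ^ e)) ?X"
    unfolding K_subspace_def
  proof (intro conjI ballI)
    show "0 \<in> ?X" by (auto intro!: exI[of _ 0])
  next
    fix u v assume "u \<in> ?X" "v \<in> ?X"
    then obtain x y where "u = vsmult x v0 + vsmult (x ^ (q ^ i)) v1" "v = vsmult y v0 + vsmult (y ^ (q ^ i)) v1"
      by blast
    then have "u + v = vsmult (x + y) v0 + vsmult ((x + y) ^ (q ^ i)) v1"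
      by (simp add: frobenius_add vs.scale_left_distrib)
    then show "u + v \<in> ?X" by blast
  next
    fix c u assume "c \<in> (subfield_of_order (q ^ e) :: 'a set)" "u \<in> ?X"
    then obtain x where x: "c ^ (q ^ e) = c" "u = vsmult x v0 + vsmult (x ^ (q ^ i)) v1"
      by (auto simp: subfield_of_order_def)
    have "vsmult c u = vsmult (c * x) v0 + vsmult ((c * x) ^ (q ^ i)) v1"
      using power_fixed_iterate[OF x(1), of k]
      by (simp add: x(2) k power_mult_distrib vs.scale_right_distrib)
    then show "vsmult c u \<in> ?X" by blast
  qed
  then have "?P e" unfolding e_def by blast
  then have "e \<le> Greatest ?P" by (rule Greatest_le_nat[of ?P e n]) (use n_pos dvd_imp_le in blast)
  then have "e \<le> 1" using assms by (simp add: max_linearity_exp_def)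
  moreover have "e > 0" using n_pos by (simp add: e_def)
  ultimately have "e = 1" by linarith
  then show ?thesis unfolding e_def by (simp only: coprime_iff_gcd_eq_1)
qed

text \<open>Both subspaces are rescaled so that their traces on \<open>T\<close> become the graphs
  of x^(q^k1) and x^(q^k2). The two scalars are combined at the end into the factor e2 / e1.\<close>

lemma equal_or_cone:
  fixes U W T :: "('r::finite \<Rightarrow> 'a) set"
  assumes U: "K_dim (subfield_of_order q) U ((CARD('r) - 1) * n)"
    and W: "K_dim (subfield_of_order q) W ((CARD('r) - 1) * n)"
    and LUW: "Lset U = Lset W" and T: "K_dim UNIV T 2"
    and U0: "K_dim (subfield_of_order q) (U \<inter> T) n"
    and W0: "K_dim (subfield_of_order q) (W \<inter> T) n"
    and L0: "Lset (U \<inter> T) = Lset (W \<inter> T)"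
    and pr: "pseudoregulus_type q T (Lset (U \<inter> T))"
    and mf: "max_linearity_exp q n (Lset (U \<inter> T)) = 1"
  shows "(\<exists>c::'a. c \<noteq> 0 \<and> W = vsmult c ` U) \<or>
    (\<exists>Lam. K_dim UNIV Lam (CARD('r) - 2) \<and> Lam \<inter> T = {0} \<and> Lset U = cone Lam (Lset (U \<inter> T)))"
proof -
  obtain i v0 v1 where v: "v0 \<in> T" "v1 \<in> T" "K_indep UNIV {v0, v1}" "v0 \<noteq> v1"
    and L: "Lset (U \<inter> T) = Lset {vsmult \<mu> v0 + vsmult (\<mu> ^ (q ^ i)) v1 |\<mu>. True}"
    using pr unfolding pseudoregulus_type_def by blast
  have i: "coprime i n" using mf unfolding L by (rule pseudoregulus_exponent_coprime)
  obtain \<alpha> \<beta> where ab: "\<And>u v. \<alpha> (u + v) = \<alpha> u + \<alpha> v" "\<And>c u. \<alpha> (vsmult c u) = c * \<alpha> u" "\<alpha> v0 = 1" "\<alpha> v1 = 0"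
    "\<And>u v. \<beta> (u + v) = \<beta> u + \<beta> v" "\<And>c u. \<beta> (vsmult c u) = c * \<beta> u" "\<beta> v0 = 0" "\<beta> v1 = 1"
    using independent_pair_coordinates[OF v(3,4)] by blast
  have T': "vs.subspace T" "card T = (q ^ n) ^ 2" using T card_field by (simp_all add: K_dim_UNIV_iff)
  interpret line_coordinates q n F v0 v1 \<alpha> \<beta> T
    by unfold_locales (use ab v T' in simp_all)
  have Lpt: "Lset (U \<inter> T) = Lset {pt \<mu> (\<mu> ^ (q ^ i)) |\<mu>. True}" unfolding L pt_def ..
  have form: "\<exists>k e. coprime k n \<and> e \<noteq> 0 \<and> X \<inter> T = vsmult e ` {pt \<mu> (\<mu> ^ (q ^ k)) |\<mu>. True}"
    if "K_dim (subfield_of_order q) (X \<inter> T) n" "Lset (X \<inter> T) = Lset (U \<inter> T)" for X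
    by (rule pseudoregulus_subspace_form[OF K_dim_base_field(1)[OF that(1)] Int_lower2
          K_dim_base_field(2)[OF that(1)] i that(2)[unfolded Lpt]]) blast
  obtain k1 e1 where 1: "coprime k1 n" "e1 \<noteq> 0" "U \<inter> T = vsmult e1 ` {pt \<mu> (\<mu> ^ (q ^ k1)) |\<mu>. True}"
    using form[OF U0 refl] by blast
  obtain k2 e2 where 2: "coprime k2 n" "e2 \<noteq> 0" "W \<inter> T = vsmult e2 ` {pt \<mu> (\<mu> ^ (q ^ k2)) |\<mu>. True}"
    using form[OF W0 L0[symmetric]] by blast
  have r: "CARD('r) > 0" by simp
  have graph: "\<exists>G. (\<forall>u v. G (u + v) = G u + G v) \<and> (\<forall>c u. c ^ q = c \<longrightarrow> G (vsmult c u) = c * G u) \<and>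
      (\<forall>x y. G (pt x y) = 0) \<and> (\<forall>u. u \<in> vsmult (1 / e) ` X \<longleftrightarrow> \<beta> u = \<alpha> u ^ (q ^ k) + G u)"
    if X: "K_dim (subfield_of_order q) X ((CARD('r) - 1) * n)" and e: "e \<noteq> 0"
      and XT: "X \<inter> T = vsmult e ` {pt \<mu> (\<mu> ^ (q ^ k)) |\<mu>. True}" for X e k
  proof -
    have "inj_on (vsmult (1 / e)) X" using e by (auto intro!: inj_onI)
    then have "card (vsmult (1 / e) ` X) = q ^ ((CARD('r) - 1) * n)"
      using K_dim_base_field(2)[OF X] by (simp add: card_image)
    then have "card (vsmult (1 / e) ` X) * q ^ n = q ^ ((CARD('r) - 1) * n + n)" by (simp add: power_add)
    also have "(CARD('r) - 1) * n + n = n * CARD('r)" using r by (cases "CARD('r)") auto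
    also have "q ^ (n * CARD('r)) = CARD('r \<Rightarrow> 'a)" by (simp add: card_fun card_field power_mult)
    finally have card: "card (vsmult (1 / e) ` X) * q ^ n = CARD('r \<Rightarrow> 'a)" .
    have "vsmult (1 / e) ` X \<inter> T = vsmult (1 / e) ` vsmult e ` {pt \<mu> (\<mu> ^ (q ^ k)) |\<mu>. True}"
      unfolding XT[symmetric] using e by (intro vsmult_image_Int_subspace[OF T'(1)]) simp
    also have "\<dots> = {pt \<mu> (\<mu> ^ (q ^ k)) |\<mu>. True}" using e by (simp add: image_image)
    finally have UT: "vsmult (1 / e) ` X \<inter> T = {pt \<mu> (\<mu> ^ (q ^ k)) |\<mu>. True}" .
    show ?thesis
      by (rule subspace_as_graph[OF K_subspace_vsmult_image[OF K_dim_base_field(1)[OF X]] card UT]) blast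
  qed
  define U' W' where "U' = vsmult (1 / e1) ` U" and "W' = vsmult (1 / e2) ` W"
  obtain G where G: "\<And>u v. G (u + v) = G u + G v" "\<And>c u. c ^ q = c \<Longrightarrow> G (vsmult c u) = c * G u"
    "\<And>x y. G (pt x y) = 0" "\<And>u. u \<in> U' \<longleftrightarrow> \<beta> u = \<alpha> u ^ (q ^ k1) + G u"
    using graph[OF U 1(2,3)] unfolding U'_def by blast
  obtain H where H: "\<And>u v. H (u + v) = H u + H v" "\<And>c u. c ^ q = c \<Longrightarrow> H (vsmult c u) = c * H u"
    "\<And>x y. H (pt x y) = 0" "\<And>u. u \<in> W' \<longleftrightarrow> \<beta> u = \<alpha> u ^ (q ^ k2) + H u"
    using graph[OF W 2(2,3)] unfolding W'_def by blast
  interpret conjugation q n F k1 by unfold_locales (rule 1(1))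
  interpret conjugate_graph q n F v0 v1 \<alpha> \<beta> T k1 G U'
    by unfold_locales (use G in \<open>simp_all add: \<sigma>_def\<close>)
  obtain s where s: "[k1 * s = 1] (mod n)" using cong_solve_coprime_nat[OF 1(1)] by auto
  \<comment> \<open>t is k2 / k1 modulo n, so \<sigma>^t acts on the field as q^k2. It is nonzero
    because k2 is coprime to n and n >= 2.\<close>
  define t where "t = (s * k2) mod n"
  have kt: "(k1 * t) mod n = k2 mod n"
  proof -
    have "[k1 * s * k2 = 1 * k2] (mod n)" using s by (intro cong_mult cong_refl)
    then show ?thesis by (simp add: t_def cong_def mod_mult_right_eq mult.assoc)
  qed
  have \<sigma>t: "x ^ (\<sigma> ^ t) = x ^ (q ^ k2)" for x :: 'a
    using frobenius_mod[of x "k1 * t"] frobenius_mod[of x k2] kt by (simp add: \<sigma>_power)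
  have "t \<noteq> 0"
  proof
    assume "t = 0"
    then have "n dvd k2" using kt by (simp add: dvd_eq_mod_eq_0)
    then have "is_unit n" using coprime_common_divisor[OF 2(1), of n] by simp
    then show False using n_ge_2 by simp
  qed
  moreover have "t < n" using n_pos by (simp add: t_def)
  moreover have W'_iff: "u \<in> W' \<longleftrightarrow> \<beta> u = \<alpha> u ^ (\<sigma> ^ t) + H u" for u using H(4) by (simp add: \<sigma>t)
  moreover have LU': "Lset U' = Lset U" and "Lset W' = Lset W"
    unfolding U'_def W'_def using 1(2) 2(2) by (simp_all add: Lset_vsmult_image)
  ultimately consider (eq) "U' = W'" | (cone) Lam where "K_dim UNIV Lam (CARD('r) - 2)" "Lam \<inter> T = {0}"
      "Lset U' = cone Lam (Lset (U' \<inter> T))"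
    using graphs_equal_or_cone[OF H(1-3), of W' t] LUW by auto
  then show ?thesis
  proof cases
    case eq
    have "W = vsmult e2 ` W'" using 2(2) by (simp add: W'_def image_image)
    also have "\<dots> = vsmult (e2 / e1) ` U" unfolding eq[symmetric] by (simp add: U'_def image_image)
    finally show ?thesis using 1(2) 2(2) by (intro disjI1 exI[of _ "e2 / e1"]) simp
  next
    case cone
    have "Lset (U' \<inter> T) = Lset (U \<inter> T)"
      unfolding U'_def using 1(2) by (simp add: vsmult_image_Int_subspace[OF T'(1)] Lset_vsmult_image)
    with cone LU' show ?thesis by auto
  qed
qed

end

theorem mainTheorem18:
  fixes q n :: nat
    and U W T :: "('r::finite \<Rightarrow> 'a::{finite,field}) set"
  assumes r: "CARD('r) \<ge> 3"
    and card_field: "CARD('a) = q ^ n"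
    and U: "K_dim (subfield_of_order q) U ((CARD('r) - 1) * n)"
    and W: "K_dim (subfield_of_order q) W ((CARD('r) - 1) * n)"
    and LUW: "Lset U = Lset W"
    and T: "K_dim UNIV T 2"
    and U0: "K_dim (subfield_of_order q) (U \<inter> T) n"
    and W0: "K_dim (subfield_of_order q) (W \<inter> T) n"
    and L0: "Lset (U \<inter> T) = Lset (W \<inter> T)"
    and pr: "pseudoregulus_type q T (Lset (U \<inter> T))"
    and mf: "max_linearity_exp q n (Lset (U \<inter> T)) = 1"
  shows "(\<exists>c::'a. c \<noteq> 0 \<and> W = vsmult c ` U) \<or>
         (\<exists>Lam. K_dim UNIV Lam (CARD('r) - 2) \<and> Lam \<inter> T = {0} \<and>
                Lset U = cone Lam (Lset (U \<inter> T)))"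
proof (cases "n \<ge> 2")
  case True
  then interpret finite_field_extension q n "TYPE('a)"
    by unfold_locales (rule card_field)
  show ?thesis by (rule equal_or_cone[OF U W LUW T U0 W0 L0 pr mf])
next
  case False
  have "card {0, 1::'a} \<le> CARD('a)" by (rule card_mono) auto
  \<comment> \<open>n = 0 would give a field with one element. For n = 1 the base field is the whole
    field, so both subspaces are closed under all scalars and are determined by their
    points.\<close>
  then have "n = 1" using False card_field by (cases n) auto
  have "x ^ q = x" for x :: 'a
  proof (cases "x = 0")
    case False
    have "x ^ q = x ^ (CARD('a) - 1) * x"
      using card_field \<open>n = 1\<close> zero_less_card_finite[where ?'a = 'a] by (simp flip: power_Suc2)
    then show ?thesis using power_card_minus_one[OF False] by simp
  qed (use card_field \<open>n = 1\<close> zero_less_card_finite[where ?'a = 'a] in simp)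
  then have "subfield_of_order q = (UNIV :: 'a set)" by (auto simp: subfield_of_order_def)
  with U W have "vs.subspace U" "vs.subspace W" by (simp_all add: K_dim_UNIV_iff)
  then have "U = W" using Lset_eq_imp_subspace_subset[of U W] Lset_eq_imp_subspace_subset[of W U] LUW by auto
  then show ?thesis by (intro disjI1 exI[of _ 1]) simp
qed

end
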